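(* Let $X \subset \mathbb{R}^d$ be a regular lattice, for $L \in \mathbb{N}$ let $X_L$ be the periodic regular lattice of side length $L$, let $\xi : X \to \mathbb{R}$ be a jump energy (a function bounded from below), let $\alpha > 0$, and let $\mathbb{P}_N = \mathbb{P}_{N(L)}$ be the measure of spatial random permutations on $X_L$ with jump energy $\xi$ and parameter $\alpha$. Assume that there exists $\varepsilon > 0$ such that $$\sum_{x \in X} e^{-(\alpha - \varepsilon)\xi(x)} < \infty.$$ Then for all $x \in X$ and all $\delta > 0$ there exists $D > 0$ such that $$\sup_{L \in \mathbb{N}} \mathbb{P}_{N(L)}\big(|\pi(x) - x| > D\big) < \delta, \qquad \sup_{L \in \mathbb{N}} \mathbb{P}_{N(L)}\big(|\pi^{-1}(x) - x| > D\big) < \delta.$$ In particular, an infinite volume measure of spatial random permutations on $X$ with jump energy $\xi$ and parameter $\alpha$ exists.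
   Context: A regular lattice is a set $X = \{\sum_{i=1}^d z_i v_i : z_i \in \mathbb{Z}\}$, where $v_1,\dots,v_d$ is a basis of $\mathbb{R}^d$. For $L \in \mathbb{N} = \{1,2,\dots\}$ put $\mathbb{Z}_L = \mathbb{Z} \cap [-L/2, L/2)$ and $X_L = \{\sum_{i=1}^d z_i v_i : z_i \in \mathbb{Z}_L\}$, and $N = N(L) = |X_L|$. For $z,w \in \mathbb{Z}_L$ the periodic difference $(z-w)_{\rm per}\in\mathbb{Z}_L$ is $z-w$ if $z-w \in \mathbb{Z}_L$, $z-w+L$ if $z-w \in [-L,-L/2)$, and $z-w-L$ if $z-w \in [L/2,L)$. For $x = \sum z_i v_i$, $y = \sum w_i v_i$ in $X_L$, the periodic difference is $(x-y)_{\rm per} = \sum_i (z_i - w_i)_{\rm per} v_i \in X_L$. Differences of elements of $X_L$ (including $\pi(x)-x$ and $\pi^{-1}(x)-x$ for $x \in X_L$ and $\pi$ a permutation of $X_L$) always denote the periodic difference, and $|\cdot|$ is the Euclidean norm on $\mathbb{R}^d$. $\mathcal{S}(X_L)$ and $\mathcal{S}(X)$ denote the sets of permutations (bijective self-maps) of $X_L$ and $X$. A jump energy is a function $\xi: X \to \mathbb{R}$ bounded from below. The measure of spatial random permutations on $X_L$ with jump energy $\xi$ and parameter $\alpha$ is the probability measure on $\mathcal{S}(X_L)$ given by $\mathbb{P}_N(\pi) = \frac{1}{Z_N} e^{-\alpha H_N(\pi)}$ with $H_N(\pi) = \sum_{x \in X_L} \xi(\pi(x)-x)$ and $Z_N$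 the normalizing constant. $\mathbb{P}_N$ is identified with a probability measure on $\mathcal{S}(X)$ by extending each $\pi \in \mathcal{S}(X_L)$ by $\pi(y) = y$ for $y \in X \setminus X_L$ (so jumps starting outside $X_L$ have length zero). For $x,y \in X$ let $B_{x,y} = \{\pi \in \mathcal{S}(X) : \pi(x) = y\}$ (cylinder sets); $\mathcal{S}(X)$ is equipped with the $\sigma$-algebra generated by all $B_{x,y}$. A probability measure $\mathbb{P}$ on $\mathcal{S}(X)$ is called an (infinite volume) measure of spatial random permutations on $X$ with jump energy $\xi$ and parameter $\alpha$ if there is a strictly increasing sequence $(L_n)$ in $\mathbb{N}$ such that the limit $\mu(B) = \lim_{n\to\infty} \mathbb{P}_{N(L_n)}(B)$ exists for all $B$ in the semi-ring generated by the cylinder sets (in particular for all finite intersections of cylinder sets) and $\mathbb{P}$ extends $\mu$. *)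

theory Defs
  imports "HOL-Probability.Probability" "HOL-Combinatorics.Permutations"
begin

section \<open>Regular lattices\<close>

definition lattice_basis :: "('d::finite \<Rightarrow> real^'d) \<Rightarrow> bool" where
  "lattice_basis v \<longleftrightarrow> inj v \<and> independent (range v) \<and> span (range v) = UNIV"

definition lattice_point :: "('d::finite \<Rightarrow> real^'d) \<Rightarrow> ('d \<Rightarrow> int) \<Rightarrow> real^'d" where
  "lattice_point v z = (\<Sum>i\<in>UNIV. of_int (z i) *\<^sub>R v i)"

definition regular_lattice :: "('d::finite \<Rightarrow> real^'d) \<Rightarrow> (real^'d) set" where
  "regular_lattice v = range (lattice_point v)"

definition int_box :: "nat \<Rightarrow> int set" where
  "int_box L = {z. - real L / 2 \<le> of_int z \<and> of_int z < real L / 2}"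

definition periodic_lattice :: "('d::finite \<Rightarrow> real^'d) \<Rightarrow> nat \<Rightarrow> (real^'d) set" where
  "periodic_lattice v L = {lattice_point v z |z. \<forall>i. z i \<in> int_box L}"

definition int_per_diff :: "nat \<Rightarrow> int \<Rightarrow> int \<Rightarrow> int" where
  "int_per_diff L z w =
     (if z - w \<in> int_box L then z - w
      else if of_int (z - w) \<in> {- real L ..< - real L / 2} then z - w + int L
      else z - w - int L)"

text \<open>
  When \<open>v\<close> is a basis, \<^term>\<open>lattice_point v\<close> is injective, so \<^term>\<open>inv (lattice_point v)\<close>
  recovers the integer coordinates of a lattice point.
  The periodic difference is meant for two points of \<^term>\<open>periodic_lattice v L\<close>; besides this it
  is only evaluated at two equal lattice points, where it is \<open>0\<close> for every \<open>L \<ge> 1\<close>.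
\<close>

definition per_diff :: "('d::finite \<Rightarrow> real^'d) \<Rightarrow> nat \<Rightarrow> real^'d \<Rightarrow> real^'d \<Rightarrow> real^'d" where
  "per_diff v L x y =
     lattice_point v
       (\<lambda>i. int_per_diff L (inv (lattice_point v) x i) (inv (lattice_point v) y i))"

section \<open>Spatial random permutations in finite volume\<close>

definition jump_energy :: "('d::finite \<Rightarrow> real^'d) \<Rightarrow> (real^'d \<Rightarrow> real) \<Rightarrow> bool" where
  "jump_energy v \<xi> \<longleftrightarrow> bdd_below (\<xi> ` regular_lattice v)"

text \<open>
  Permutations of a set \<open>A\<close> are represented as functions on the whole type that fix every point
  outside \<open>A\<close>. A permutation of \<^term>\<open>periodic_lattice v L\<close> is thereby already extended by the
  identity to \<^term>\<open>regular_lattice v\<close>.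
\<close>

definition perms :: "'a set \<Rightarrow> ('a \<Rightarrow> 'a) set" where
  "perms A = {\<pi>. \<pi> permutes A}"

definition cylinder :: "'a set \<Rightarrow> 'a \<Rightarrow> 'a \<Rightarrow> ('a \<Rightarrow> 'a) set" where
  "cylinder A x y = {\<pi> \<in> perms A. \<pi> x = y}"

definition perm_space :: "'a set \<Rightarrow> ('a \<Rightarrow> 'a) measure" where
  "perm_space A = sigma (perms A) {cylinder A x y |x y. x \<in> A \<and> y \<in> A}"

definition hamiltonian ::
  "('d::finite \<Rightarrow> real^'d) \<Rightarrow> (real^'d \<Rightarrow> real) \<Rightarrow> nat \<Rightarrow> (real^'d \<Rightarrow> real^'d) \<Rightarrow> real" where
  "hamiltonian v \<xi> L \<pi> = (\<Sum>x\<in>periodic_lattice v L. \<xi> (per_diff v L (\<pi> x) x))"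

definition partition_function ::
  "('d::finite \<Rightarrow> real^'d) \<Rightarrow> (real^'d \<Rightarrow> real) \<Rightarrow> real \<Rightarrow> nat \<Rightarrow> real" where
  "partition_function v \<xi> \<alpha> L =
     (\<Sum>\<pi>\<in>perms (periodic_lattice v L). exp (- \<alpha> * hamiltonian v \<xi> L \<pi>))"

definition finite_srp ::
  "('d::finite \<Rightarrow> real^'d) \<Rightarrow> (real^'d \<Rightarrow> real) \<Rightarrow> real \<Rightarrow> nat \<Rightarrow> (real^'d \<Rightarrow> real^'d) measure" where
  "finite_srp v \<xi> \<alpha> L =
     point_measure (perms (periodic_lattice v L))
       (\<lambda>\<pi>. ennreal (exp (- \<alpha> * hamiltonian v \<xi> L \<pi>) / partition_function v \<xi> \<alpha> L))"

definition extended_srp ::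
  "('d::finite \<Rightarrow> real^'d) \<Rightarrow> (real^'d \<Rightarrow> real) \<Rightarrow> real \<Rightarrow> nat \<Rightarrow> (real^'d \<Rightarrow> real^'d) measure" where
  "extended_srp v \<xi> \<alpha> L =
     distr (finite_srp v \<xi> \<alpha> L) (perm_space (regular_lattice v)) (\<lambda>\<pi>. \<pi>)"

section \<open>Infinite volume measures\<close>

text \<open>
  The semi-ring generated by the cylinder sets: finite intersections of cylinder sets and
  complements of cylinder sets. Cylinder sets and their finite intersections alone do not form a
  semi-ring, because the complement of a cylinder set is not a finite union of such sets if \<open>A\<close> is
  infinite.
\<close>

definition cylinder_semiring :: "'a set \<Rightarrow> ('a \<Rightarrow> 'a) set set" where
  "cylinder_semiring A =
     {{\<pi> \<in> perms A. (\<forall>(x, y)\<in>F. \<pi> \<in> cylinder A x y) \<and> (\<forall>(x, y)\<in>G. \<pi> \<notin> cylinder A x y)} |F G.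
        finite F \<and> finite G \<and> F \<subseteq> A \<times> A \<and> G \<subseteq> A \<times> A}"

definition infinite_volume_srp ::
  "('d::finite \<Rightarrow> real^'d) \<Rightarrow> (real^'d \<Rightarrow> real) \<Rightarrow> real \<Rightarrow> (real^'d \<Rightarrow> real^'d) measure \<Rightarrow> bool" where
  "infinite_volume_srp v \<xi> \<alpha> P \<longleftrightarrow>
     prob_space P \<and>
     sets P = sets (perm_space (regular_lattice v)) \<and>
     (\<exists>L :: nat \<Rightarrow> nat. strict_mono L \<and> (\<forall>n. L n \<ge> 1) \<and>
        (\<forall>B\<in>cylinder_semiring (regular_lattice v).
           (\<lambda>n. measure (extended_srp v \<xi> \<alpha> (L n)) B) \<longlonglongrightarrow> measure P B))"

end

theory Submission
  imports Defs "HOL-Complex_Analysis.Great_Picard"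
begin

text \<open>
  Tightness comes from an entropy bound. Write \<open>H\<close> for the energy and \<open>N\<close> for the number of points of
  the torus. Under the Gibbs measure, the expectation of \<open>exp (\<epsilon> H)\<close> is the quotient of the
  partition functions at \<open>\<alpha> - \<epsilon>\<close> and \<open>\<alpha>\<close>. The numerator is at most \<open>C ^ N\<close>, where \<open>C\<close> is the assumed
  finite sum over the lattice, because the sum over permutations is at most the sum over all
  self-maps; the denominator is at least the weight \<open>exp (- \<alpha> N \<xi> 0)\<close> of the identity. By Jensen's
  inequality the expected energy is therefore at most a constant times \<open>N\<close>
  (\<open>gibbs_expected_energy_le\<close>). Translations of the torus preserve the Gibbs measure, so the expected
  energy of the jump at any single point is bounded uniformly in \<open>L\<close>, and Markov's inequality bounds
  the probability that a jump, out of the point or into it, has large energy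
  (\<open>gibbs_jump_prob_le\<close>). Summability forces \<open>\<xi>\<close> to tend to infinity (\<open>finite_low_energy\<close>), hence
  long jumps have large energy (\<open>srp_long_jump_prob_le\<close>).

  For the infinite volume limit, the pairs \<open>(\<pi> x, inv \<pi> x)\<close>, for \<open>x\<close> in the lattice, form a sequence of
  random functions on a countable index set with tight coordinates. A diagonal subsequence makes all finite-dimensional
  distributions converge, tightness makes the limits probability distributions, and the
  Daniell-Kolmogorov theorem provides a measure with these marginals
  (\<open>tight_product_pmf_subsequence\<close>). That \<open>\<pi>\<close> and \<open>inv \<pi>\<close> are inverse to each other is
  expressed by countably many events depending on two coordinates each, so it
  holds almost surely in the limit, which is thereby a random permutation
  (\<open>tight_perms_subsequence\<close>).
\<close>

section \<open>Gibbs measures on the permutations of a finite set\<close>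

text \<open>
  The energy of a permutation of \<open>A\<close> is a sum of one term per jump, where \<open>\<phi> x y\<close> is the energy of
  a jump from \<open>x\<close> to \<open>y\<close>.
\<close>

definition perm_energy :: "('a \<Rightarrow> 'a \<Rightarrow> real) \<Rightarrow> 'a set \<Rightarrow> ('a \<Rightarrow> 'a) \<Rightarrow> real" where
  "perm_energy \<phi> A \<pi> = (\<Sum>x\<in>A. \<phi> x (\<pi> x))"

text \<open>
  The normalising constant, and the probability measure with weights proportional to
  \<open>exp (- \<alpha> H)\<close>, as a discrete distribution on functions that fix every point outside \<open>A\<close>.
\<close>

definition gibbs_partition :: "real \<Rightarrow> ('a \<Rightarrow> 'a \<Rightarrow> real) \<Rightarrow> 'a set \<Rightarrow> real" where
  "gibbs_partition \<alpha> \<phi> A = (\<Sum>\<pi>\<in>perms A. exp (- \<alpha> * perm_energy \<phi> A \<pi>))"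

definition gibbs_perm :: "real \<Rightarrow> ('a \<Rightarrow> 'a \<Rightarrow> real) \<Rightarrow> 'a set \<Rightarrow> ('a \<Rightarrow> 'a) pmf" where
  "gibbs_perm \<alpha> \<phi> A = embed_pmf
     (\<lambda>\<pi>. if \<pi> \<in> perms A then exp (- \<alpha> * perm_energy \<phi> A \<pi>) / gibbs_partition \<alpha> \<phi> A else 0)"

lemma finite_perms: "finite A \<Longrightarrow> finite (perms A)"
  by (simp add: perms_def finite_permutations)

lemma id_in_perms: "id \<in> perms A"
  by (simp add: perms_def permutes_id)

context
  fixes A :: "'a set"
  assumes fin: "finite A"
begin

lemma gibbs_partition_pos: "gibbs_partition \<alpha> \<phi> A > 0"
  unfolding gibbs_partition_def
  by (rule sum_pos) (use fin id_in_perms in \<open>auto intro: finite_perms\<close>)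

lemma pmf_gibbs_perm:
  "pmf (gibbs_perm \<alpha> \<phi> A) \<pi> =
     (if \<pi> \<in> perms A then exp (- \<alpha> * perm_energy \<phi> A \<pi>) / gibbs_partition \<alpha> \<phi> A else 0)"
  unfolding gibbs_perm_def
proof (rule pmf_embed_pmf)
  let ?w = "\<lambda>\<pi>. exp (- \<alpha> * perm_energy \<phi> A \<pi>) / gibbs_partition \<alpha> \<phi> A"
  note Z = gibbs_partition_pos[of \<alpha> \<phi>]
  show "0 \<le> (if \<pi> \<in> perms A then ?w \<pi> else 0)" for \<pi>
    using Z by simp
  have "(\<integral>\<^sup>+\<pi>. ennreal (if \<pi> \<in> perms A then ?w \<pi> else 0) \<partial>count_space UNIV)
      = (\<Sum>\<pi>\<in>perms A. ennreal (?w \<pi>))"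
    using fin Z
    by (subst nn_integral_count_space'[where A = "perms A"])
       (auto intro!: sum.cong finite_perms simp: divide_less_0_iff)
  also have "\<dots> = ennreal (\<Sum>\<pi>\<in>perms A. ?w \<pi>)"
    using Z by (intro sum_ennreal) simp
  also have "(\<Sum>\<pi>\<in>perms A. ?w \<pi>) = 1"
    using Z unfolding sum_divide_distrib[symmetric] gibbs_partition_def[symmetric] by simp
  finally show "(\<integral>\<^sup>+\<pi>. ennreal (if \<pi> \<in> perms A then ?w \<pi> else 0) \<partial>count_space UNIV) = 1"
    by simp
qed

lemma set_gibbs_perm: "set_pmf (gibbs_perm \<alpha> \<phi> A) = perms A"
  using gibbs_partition_pos[of \<alpha> \<phi>] by (auto simp: set_pmf_eq pmf_gibbs_perm)

lemma integrable_gibbs_perm: "integrable (gibbs_perm \<alpha> \<phi> A) (f :: _ \<Rightarrow> real)"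
  by (rule integrable_measure_pmf_finite) (simp add: set_gibbs_perm finite_perms fin)

lemma expectation_gibbs_perm:
  "measure_pmf.expectation (gibbs_perm \<alpha> \<phi> A) f =
     (\<Sum>\<pi>\<in>perms A. f \<pi> * exp (- \<alpha> * perm_energy \<phi> A \<pi>)) / gibbs_partition \<alpha> \<phi> A"
  by (subst integral_measure_pmf_real[where A = "perms A"])
     (auto simp: finite_perms fin set_gibbs_perm pmf_gibbs_perm sum_divide_distrib)

lemma gibbs_partition_ge_id: "gibbs_partition \<alpha> \<phi> A \<ge> exp (- \<alpha> * (\<Sum>x\<in>A. \<phi> x x))"
proof -
  have "exp (- \<alpha> * perm_energy \<phi> A id) \<le> gibbs_partition \<alpha> \<phi> A"
    unfolding gibbs_partition_def
    by (rule member_le_sum[OF id_in_perms]) (auto simp: finite_perms fin)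
  thus ?thesis by (simp add: perm_energy_def)
qed

text \<open>The sum over permutations is at most the sum over all self-maps, which factorises.\<close>

lemma gibbs_partition_le_prod:
  "gibbs_partition \<beta> \<phi> A \<le> (\<Prod>x\<in>A. \<Sum>y\<in>A. exp (- \<beta> * \<phi> x y))"
proof -
  let ?w = "\<lambda>f. \<Prod>x\<in>A. exp (- \<beta> * \<phi> x (f x))"
  have inj: "inj_on (\<lambda>\<pi>. restrict \<pi> A) (perms A)"
  proof (rule inj_onI)
    fix \<pi> \<sigma> assume *: "\<pi> \<in> perms A" "\<sigma> \<in> perms A" "restrict \<pi> A = restrict \<sigma> A"
    show "\<pi> = \<sigma>"
    proof
      fix x show "\<pi> x = \<sigma> x"
        using * by (cases "x \<in> A") (auto simp: perms_def permutes_def dest: fun_cong[where x = x])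
    qed
  qed
  have "gibbs_partition \<beta> \<phi> A = (\<Sum>\<pi>\<in>perms A. ?w (restrict \<pi> A))"
    unfolding gibbs_partition_def perm_energy_def
    by (intro sum.cong) (simp_all add: sum_distrib_left exp_sum fin flip: sum_negf)
  also have "\<dots> = (\<Sum>f\<in>(\<lambda>\<pi>. restrict \<pi> A) ` perms A. ?w f)"
    by (simp add: sum.reindex[OF inj])
  also have "\<dots> \<le> (\<Sum>f\<in>A \<rightarrow>\<^sub>E A. ?w f)"
    by (rule sum_mono2)
       (auto simp: fin finite_PiE perms_def permutes_in_image intro!: prod_nonneg)
  also have "\<dots> = (\<Prod>x\<in>A. \<Sum>y\<in>A. exp (- \<beta> * \<phi> x y))"
    by (rule prod_sum_PiE[symmetric]) (auto simp: fin)
  finally show ?thesis .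
qed

text \<open>
  The expected energy grows at most linearly in the size of \<open>A\<close>: lowering the parameter by \<open>\<epsilon>\<close> costs
  the factor \<open>E (exp (\<epsilon> H)) = Z (\<alpha> - \<epsilon>) / Z \<alpha>\<close>, which is at most exponential in the size of \<open>A\<close>.
\<close>

lemma gibbs_expected_energy_le:
  assumes "\<epsilon> > 0" and "C > 0"
    and C: "\<And>x. x \<in> A \<Longrightarrow> (\<Sum>y\<in>A. exp (- (\<alpha> - \<epsilon>) * \<phi> x y)) \<le> C"
    and diag: "\<And>x. x \<in> A \<Longrightarrow> \<phi> x x = e"
  shows "measure_pmf.expectation (gibbs_perm \<alpha> \<phi> A) (perm_energy \<phi> A)
           \<le> card A * ((ln C + \<alpha> * e) / \<epsilon>)"
proof -
  define m where "m = card A * ((ln C + \<alpha> * e) / \<epsilon>)"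
  let ?H = "perm_energy \<phi> A" and ?Z = "gibbs_partition \<alpha> \<phi> A"
  let ?E = "measure_pmf.expectation (gibbs_perm \<alpha> \<phi> A)"
  have \<epsilon>m: "\<epsilon> * m = card A * (ln C + \<alpha> * e)"
    using \<open>\<epsilon> > 0\<close> by (simp add: m_def)
  \<comment> \<open>Jensen's inequality for \<open>exp\<close>, by the tangent line at \<open>m\<close>.\<close>
  have "1 + \<epsilon> * (?E ?H - m) = ?E (\<lambda>\<pi>. 1 + \<epsilon> * (?H \<pi> - m))"
    by (simp add: integrable_gibbs_perm)
  also have "\<dots> \<le> ?E (\<lambda>\<pi>. exp (\<epsilon> * (?H \<pi> - m)))"
    by (intro integral_mono integrable_gibbs_perm exp_ge_add_one_self)
  also have "\<dots> = gibbs_partition (\<alpha> - \<epsilon>) \<phi> A * exp (- (\<epsilon> * m)) / ?Z"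
    unfolding expectation_gibbs_perm gibbs_partition_def[of "\<alpha> - \<epsilon>"] sum_distrib_right
    by (simp add: algebra_simps flip: exp_add)
  also have "\<dots> \<le> C ^ card A * exp (- (\<epsilon> * m)) / exp (- \<alpha> * (\<Sum>x\<in>A. \<phi> x x))"
  proof (intro frac_le mult_right_mono)
    have "gibbs_partition (\<alpha> - \<epsilon>) \<phi> A \<le> (\<Prod>x\<in>A. \<Sum>y\<in>A. exp (- (\<alpha> - \<epsilon>) * \<phi> x y))"
      by (rule gibbs_partition_le_prod)
    also have "\<dots> \<le> (\<Prod>x\<in>A. C)"
      by (intro prod_mono conjI sum_nonneg C) auto
    finally show "gibbs_partition (\<alpha> - \<epsilon>) \<phi> A \<le> C ^ card A" by simp
    show "exp (- \<alpha> * (\<Sum>x\<in>A. \<phi> x x)) \<le> gibbs_partition \<alpha> \<phi> A"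
      by (rule gibbs_partition_ge_id)
  qed (use \<open>C > 0\<close> in auto)
  also have "\<dots> = exp (card A * ln C - \<epsilon> * m + \<alpha> * (card A * e))"
    using \<open>C > 0\<close> diag exp_of_nat_mult[of "card A" "ln C"]
    by (simp add: exp_add exp_diff exp_minus field_simps)
  also have "\<dots> = 1"
    by (simp add: \<epsilon>m algebra_simps)
  finally show ?thesis
    using \<open>\<epsilon> > 0\<close> by (simp add: mult_le_0_iff m_def)
qed

lemma gibbs_perm_conj:
  assumes \<tau>: "\<tau> permutes A" and inv: "\<And>x y. x \<in> A \<Longrightarrow> y \<in> A \<Longrightarrow> \<phi> (\<tau> x) (\<tau> y) = \<phi> x y"
  shows "map_pmf (\<lambda>\<pi>. \<tau> \<circ> \<pi> \<circ> inv \<tau>) (gibbs_perm \<alpha> \<phi> A) = gibbs_perm \<alpha> \<phi> A"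
proof (rule pmf_eqI)
  fix \<pi>
  let ?c = "\<lambda>\<pi>. \<tau> \<circ> \<pi> \<circ> inv \<tau>"
  have bij: "bij \<tau>" using \<tau> by (rule permutes_bij)
  have "inj ?c"
    by (rule inj_on_inverseI[of _ "\<lambda>\<pi>. inv \<tau> \<circ> \<pi> \<circ> \<tau>"])
       (use bij in \<open>auto simp: fun_eq_iff bij_is_inj bij_is_surj surj_f_inv_f\<close>)
  define \<sigma> where "\<sigma> = inv \<tau> \<circ> \<pi> \<circ> \<tau>"
  have \<pi>: "\<pi> = ?c \<sigma>"
    using bij by (auto simp: \<sigma>_def fun_eq_iff bij_is_surj surj_f_inv_f)
  have perm_iff: "\<pi> \<in> perms A \<longleftrightarrow> \<sigma> \<in> perms A"
  proof
    show "\<pi> \<in> perms A \<Longrightarrow> \<sigma> \<in> perms A"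
      unfolding perms_def \<sigma>_def using \<tau> by (auto intro!: permutes_compose permutes_inv)
    show "\<sigma> \<in> perms A \<Longrightarrow> \<pi> \<in> perms A"
      unfolding perms_def \<pi> using \<tau> by (auto intro!: permutes_compose permutes_inv)
  qed
  have "perm_energy \<phi> A \<pi> = perm_energy \<phi> A \<sigma>" if "\<sigma> \<in> perms A"
  proof -
    have "perm_energy \<phi> A \<pi> = (\<Sum>x\<in>\<tau> ` A. \<phi> x (\<pi> x))"
      unfolding perm_energy_def by (simp add: permutes_image[OF \<tau>])
    also have "\<dots> = (\<Sum>x\<in>A. \<phi> (\<tau> x) (\<tau> (\<sigma> x)))"
      using bij by (subst sum.reindex) (auto simp: \<pi> inj_on_def bij_is_inj dest: bij_is_inj injD)
    also have "\<dots> = perm_energy \<phi> A \<sigma>"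
      unfolding perm_energy_def using that
      by (intro sum.cong refl inv) (auto simp: perms_def permutes_in_image)
    finally show ?thesis .
  qed
  hence "pmf (gibbs_perm \<alpha> \<phi> A) \<pi> = pmf (gibbs_perm \<alpha> \<phi> A) \<sigma>"
    by (simp add: pmf_gibbs_perm perm_iff)
  thus "pmf (map_pmf ?c (gibbs_perm \<alpha> \<phi> A)) \<pi> = pmf (gibbs_perm \<alpha> \<phi> A) \<pi>"
    using pmf_map_inj'[OF \<open>inj ?c\<close>, of "gibbs_perm \<alpha> \<phi> A" \<sigma>] \<pi> by simp
qed

text \<open>
  If symmetries of \<open>\<phi>\<close> and \<open>U\<close> act transitively on \<open>A\<close>, the probability of a jump in \<open>U\<close> is the
  same from every point, so it is the expected fraction of such jumps; this is
  controlled by the expected energy when every jump in \<open>U\<close> has energy above \<open>K\<close>. The fraction of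
  points with an incoming jump in \<open>U\<close> is the same.
\<close>

lemma gibbs_jump_prob_le:
  assumes "\<epsilon> > 0" and "C > 0"
    and C: "\<And>x. x \<in> A \<Longrightarrow> (\<Sum>y\<in>A. exp (- (\<alpha> - \<epsilon>) * \<phi> x y)) \<le> C"
    and diag: "\<And>x. x \<in> A \<Longrightarrow> \<phi> x x = e"
    and lower: "\<And>x y. x \<in> A \<Longrightarrow> y \<in> A \<Longrightarrow> - b \<le> \<phi> x y"
    and U: "\<And>x y. x \<in> A \<Longrightarrow> y \<in> A \<Longrightarrow> U x y \<Longrightarrow> K \<le> \<phi> x y"
    and "K + b > 0"
    and trans: "\<And>x x'. x \<in> A \<Longrightarrow> x' \<in> A \<Longrightarrow> \<exists>\<tau>. \<tau> permutes A \<and> \<tau> x = x' \<and>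
      (\<forall>y\<in>A. \<forall>z\<in>A. \<phi> (\<tau> y) (\<tau> z) = \<phi> y z \<and> U (\<tau> y) (\<tau> z) = U y z)"
    and x: "x \<in> A"
  defines "p \<equiv> gibbs_perm \<alpha> \<phi> A"
  shows "measure_pmf.prob p {\<pi>. U x (\<pi> x)} \<le> ((ln C + \<alpha> * e) / \<epsilon> + b) / (K + b)" (is "?P1 \<le> ?B")
    and "measure_pmf.prob p {\<pi>. U (inv \<pi> x) x} \<le> ((ln C + \<alpha> * e) / \<epsilon> + b) / (K + b)"
proof -
  let ?E = "measure_pmf.expectation p"
  have setp: "set_pmf p = perms A" by (simp add: p_def set_gibbs_perm)
  have int: "integrable p (f :: _ \<Rightarrow> real)" for f
    unfolding p_def by (rule integrable_gibbs_perm)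
  have "card A > 0" using x fin by (auto simp: card_gt_0_iff)
  \<comment> \<open>Markov's inequality, summed over the starting points of the jumps.\<close>
  have count: "?E (\<lambda>\<pi>. \<Sum>y\<in>A. of_bool (U y (\<pi> y))) \<le> card A * ?B"
  proof -
    have "?E (\<lambda>\<pi>. \<Sum>y\<in>A. of_bool (U y (\<pi> y))) \<le> ?E (\<lambda>\<pi>. (perm_energy \<phi> A \<pi> + card A * b) / (K + b))"
    proof (rule integral_mono_AE[OF int int], rule AE_pmfI)
      fix \<pi> assume "\<pi> \<in> set_pmf p"
      hence \<pi>: "\<pi> y \<in> A" if "y \<in> A" for y
        using that by (auto simp: setp perms_def permutes_in_image)
      have "(\<Sum>y\<in>A. of_bool (U y (\<pi> y))) \<le> (\<Sum>y\<in>A. (\<phi> y (\<pi> y) + b) / (K + b))"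
      proof (rule sum_mono)
        fix y assume y: "y \<in> A"
        show "of_bool (U y (\<pi> y)) \<le> (\<phi> y (\<pi> y) + b) / (K + b)"
          using U[OF y \<pi>[OF y]] lower[OF y \<pi>[OF y]] \<open>K + b > 0\<close> by (auto simp: field_simps)
      qed
      also have "\<dots> = (perm_energy \<phi> A \<pi> + card A * b) / (K + b)"
        by (simp add: perm_energy_def sum.distrib flip: sum_divide_distrib)
      finally show "(\<Sum>y\<in>A. of_bool (U y (\<pi> y))) \<le> (perm_energy \<phi> A \<pi> + card A * b) / (K + b)" .
    qed
    also have "\<dots> = (?E (perm_energy \<phi> A) + card A * b) / (K + b)"
      by (simp add: int)
    also have "\<dots> \<le> (card A * ((ln C + \<alpha> * e) / \<epsilon>) + card A * b) / (K + b)"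
      using gibbs_expected_energy_le[of \<epsilon> C \<alpha> \<phi> e, OF \<open>\<epsilon> > 0\<close> \<open>C > 0\<close> C diag] \<open>K + b > 0\<close>
      by (intro divide_right_mono add_right_mono) (auto simp: p_def)
    finally show ?thesis by (simp add: algebra_simps)
  qed
  \<comment> \<open>\<open>W \<pi> x\<close> stands for the jump out of \<open>x\<close> or the jump into \<open>x\<close> being in \<open>U\<close>.\<close>
  have bound: "measure_pmf.prob p {\<pi>. W \<pi> x} \<le> ?B"
    if W: "\<And>\<pi> \<tau> y. \<pi> \<in> perms A \<Longrightarrow> \<tau> permutes A \<Longrightarrow>
        \<forall>y\<in>A. \<forall>z\<in>A. U (\<tau> y) (\<tau> z) = U y z \<Longrightarrow> y \<in> A \<Longrightarrow> W (\<tau> \<circ> \<pi> \<circ> inv \<tau>) (\<tau> y) = W \<pi> y"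
      and W_sum: "\<And>\<pi>. \<pi> \<in> perms A \<Longrightarrow>
        (\<Sum>y\<in>A. of_bool (W \<pi> y) :: real) = (\<Sum>y\<in>A. of_bool (U y (\<pi> y)))" for W
  proof -
    have const: "measure_pmf.prob p {\<pi>. W \<pi> y} = measure_pmf.prob p {\<pi>. W \<pi> x}" if y: "y \<in> A" for y
    proof -
      obtain \<tau> where \<tau>: "\<tau> permutes A" "\<tau> x = y"
        "\<forall>y\<in>A. \<forall>z\<in>A. \<phi> (\<tau> y) (\<tau> z) = \<phi> y z \<and> U (\<tau> y) (\<tau> z) = U y z"
        using trans[OF x y] by blast
      have "measure_pmf.prob p {\<pi>. W \<pi> y}
          = measure_pmf.prob (map_pmf (\<lambda>\<pi>. \<tau> \<circ> \<pi> \<circ> inv \<tau>) p) {\<pi>. W \<pi> y}"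
        unfolding p_def by (subst gibbs_perm_conj) (use \<tau> in auto)
      also have "\<dots> = measure_pmf.prob p {\<pi>. W (\<tau> \<circ> \<pi> \<circ> inv \<tau>) (\<tau> x)}"
        by (simp add: \<tau>(2) vimage_def)
      also have "\<dots> = measure_pmf.prob p {\<pi>. W \<pi> x}"
        using W[OF _ \<tau>(1) _ x] \<tau>(3)
        by (intro measure_pmf.finite_measure_eq_AE AE_pmfI) (auto simp: setp)
      finally show ?thesis .
    qed
    have "card A * measure_pmf.prob p {\<pi>. W \<pi> x} = (\<Sum>y\<in>A. measure_pmf.prob p {\<pi>. W \<pi> y})"
      by (simp add: const)
    also have "\<dots> = (\<Sum>y\<in>A. ?E (indicator {\<pi>. W \<pi> y}))"
      by simp
    also have "\<dots> = ?E (\<lambda>\<pi>. \<Sum>y\<in>A. indicator {\<pi>. W \<pi> y} \<pi>)"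
      by (rule Bochner_Integration.integral_sum[symmetric]) (rule int)
    also have "\<dots> = ?E (\<lambda>\<pi>. \<Sum>y\<in>A. of_bool (U y (\<pi> y)))"
      using W_sum by (intro integral_cong_AE AE_pmfI) (auto simp: setp indicator_def of_bool_def)
    also have "\<dots> \<le> card A * ?B" by (rule count)
    finally show ?thesis
      using \<open>card A > 0\<close> by (subst (asm) mult_le_cancel_left_pos) auto
  qed
  show "?P1 \<le> ?B"
  proof (rule bound)
    fix \<pi> \<tau> y assume "\<pi> \<in> perms A" "\<tau> permutes A"
      "\<forall>y\<in>A. \<forall>z\<in>A. U (\<tau> y) (\<tau> z) = U y z" "y \<in> A"
    thus "U (\<tau> y) ((\<tau> \<circ> \<pi> \<circ> inv \<tau>) (\<tau> y)) = U y (\<pi> y)"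
      by (simp add: permutes_inverses perms_def permutes_in_image)
  qed simp
  show "measure_pmf.prob p {\<pi>. U (inv \<pi> x) x} \<le> ?B"
  proof (rule bound)
    fix \<pi> \<tau> y assume *: "\<pi> \<in> perms A" "\<tau> permutes A"
      "\<forall>y\<in>A. \<forall>z\<in>A. U (\<tau> y) (\<tau> z) = U y z" "y \<in> A"
    have "inv (\<tau> \<circ> \<pi> \<circ> inv \<tau>) = \<tau> \<circ> inv \<pi> \<circ> inv \<tau>"
      using * unfolding perms_def
      by (intro inv_unique_comp) (auto simp: fun_eq_iff permutes_inverses)
    thus "U (inv (\<tau> \<circ> \<pi> \<circ> inv \<tau>) (\<tau> y)) (\<tau> y) = U (inv \<pi> y) y"
      using * permutes_inv[of \<pi> A] by (simp add: permutes_inverses perms_def permutes_in_image)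
  next
    fix \<pi> assume "\<pi> \<in> perms A"
    hence \<pi>: "\<pi> permutes A" by (simp add: perms_def)
    have "(\<Sum>y\<in>A. of_bool (U (inv \<pi> y) y) :: real) = (\<Sum>y\<in>\<pi> ` A. of_bool (U (inv \<pi> y) y))"
      by (simp add: permutes_image[OF \<pi>])
    also have "\<dots> = (\<Sum>y\<in>A. of_bool (U y (\<pi> y)))"
      by (subst sum.reindex)
         (auto simp: permutes_inverses[OF \<pi>] intro: inj_on_subset[OF permutes_inj[OF \<pi>]])
    finally show "(\<Sum>y\<in>A. of_bool (U (inv \<pi> y) y) :: real) = (\<Sum>y\<in>A. of_bool (U y (\<pi> y)))" .
  qed
qed

end

section \<open>Limits of tight sequences of discrete distributions\<close>

text \<open>
  Tightness prevents loss of mass, so that the pointwise limit of the weights is again a probability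
  distribution.
\<close>

lemma tight_pmf_limit:
  fixes p :: "nat \<Rightarrow> 'b pmf"
  assumes conv: "\<And>x. convergent (\<lambda>n. pmf (p n) x)"
    and tight: "\<And>\<epsilon>. \<epsilon> > 0 \<Longrightarrow> \<exists>K. finite K \<and> (\<forall>n. measure_pmf.prob (p n) (- K) \<le> \<epsilon>)"
  shows "\<exists>q. \<forall>B. (\<lambda>n. measure_pmf.prob (p n) B) \<longlonglongrightarrow> measure_pmf.prob q B"
proof -
  define c where "c x = lim (\<lambda>n. pmf (p n) x)" for x
  have c: "(\<lambda>n. pmf (p n) x) \<longlonglongrightarrow> c x" for x
    using conv unfolding c_def by (simp add: convergent_LIMSEQ_iff)
  have c0: "c x \<ge> 0" for x
    by (rule LIMSEQ_le_const[OF c]) (auto intro: pmf_nonneg)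
  have c_fin: "(\<lambda>n. measure_pmf.prob (p n) K) \<longlonglongrightarrow> sum c K" if "finite K" for K
    using that by (auto simp: measure_measure_pmf_finite intro!: tendsto_sum c)
  have sum_le: "sum c K \<le> 1" if "finite K" for K
    by (rule LIMSEQ_le_const2[OF c_fin[OF that]]) (auto intro: measure_pmf.prob_le_1)
  have sum_ge: "\<exists>K. finite K \<and> sum c K \<ge> 1 - \<epsilon> \<and> (\<forall>n. measure_pmf.prob (p n) (- K) \<le> \<epsilon>)"
    if \<epsilon>: "\<epsilon> > 0" for \<epsilon>
  proof -
    obtain K where K: "finite K" "\<And>n. measure_pmf.prob (p n) (- K) \<le> \<epsilon>"
      using tight[OF \<epsilon>] by blast
    have "measure_pmf.prob (p n) K \<ge> 1 - \<epsilon>" for n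
      using K(2)[of n] measure_pmf.prob_compl[of K "p n"] by (simp add: Compl_eq_Diff_UNIV)
    hence "sum c K \<ge> 1 - \<epsilon>"
      by (intro LIMSEQ_le_const[OF c_fin[OF K(1)]]) auto
    with K show ?thesis by blast
  qed
  have has: "(c has_sum 1) UNIV"
    unfolding has_sum_def
  proof (rule order_tendstoI)
    fix a :: real assume "a < 1"
    then obtain K where K: "finite K" "sum c K \<ge> 1 - (1 - a) / 2"
      using sum_ge[of "(1 - a) / 2"] by auto
    have "a < sum c F" if "finite F" "K \<subseteq> F" for F
    proof -
      have "a < sum c K" using K \<open>a < 1\<close> by (simp add: field_simps)
      also have "\<dots> \<le> sum c F" using that c0 by (intro sum_mono2) auto
      finally show ?thesis .
    qed
    thus "\<forall>\<^sub>F F in finite_subsets_at_top UNIV. a < sum c F"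
      unfolding eventually_finite_subsets_at_top using K by (intro exI[of _ K]) auto
  next
    fix a :: real assume "1 < a"
    hence "sum c F < a" if "finite F" for F using sum_le[OF that] by simp
    thus "\<forall>\<^sub>F F in finite_subsets_at_top UNIV. sum c F < a"
      unfolding eventually_finite_subsets_at_top by (intro exI[of _ "{}"]) auto
  qed
  hence "(\<lambda>x. norm (c x)) summable_on UNIV"
    using c0 by (auto simp: summable_on_def)
  hence abs: "Infinite_Set_Sum.abs_summable_on c UNIV" by (simp only: abs_summable_equivalent)
  have one: "(\<integral>\<^sup>+x. ennreal (c x) \<partial>count_space UNIV) = 1"
    using nn_integral_conv_infsetsum[OF abs] infsetsum_infsum[OF abs] infsumI[OF has] c0 by simp
  define q where "q = embed_pmf c"
  have pmf_q: "pmf q x = c x" for x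
    unfolding q_def by (rule pmf_embed_pmf[OF c0 one])
  have "(\<lambda>n. measure_pmf.prob (p n) B) \<longlonglongrightarrow> measure_pmf.prob q B" for B
  proof (rule LIMSEQ_I)
    fix e :: real assume "e > 0"
    then obtain K where K: "finite K" "sum c K \<ge> 1 - e / 4"
        "\<And>n. measure_pmf.prob (p n) (- K) \<le> e / 4"
      using sum_ge[of "e / 4"] by auto
    have split: "\<bar>measure_pmf.prob s B - measure_pmf.prob s (B \<inter> K)\<bar> \<le> measure_pmf.prob s (- K)" for s
    proof -
      have "measure_pmf.prob s B = measure_pmf.prob s (B \<inter> K) + measure_pmf.prob s (B - K)"
        by (subst measure_pmf.finite_measure_Union[symmetric]) (auto intro!: arg_cong[where f = "measure_pmf.prob s"])
      moreover have "measure_pmf.prob s (B - K) \<le> measure_pmf.prob s (- K)"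
        by (intro measure_pmf.finite_measure_mono) auto
      ultimately show ?thesis by simp
    qed
    have qK: "measure_pmf.prob q (- K) \<le> e / 4"
      using K(1,2) measure_pmf.prob_compl[of K q]
      by (simp add: Compl_eq_Diff_UNIV measure_measure_pmf_finite pmf_q)
    have "(\<lambda>n. measure_pmf.prob (p n) (B \<inter> K)) \<longlonglongrightarrow> measure_pmf.prob q (B \<inter> K)"
      using c_fin[of "B \<inter> K"] K(1) by (simp add: measure_measure_pmf_finite pmf_q)
    then obtain N where N: "\<And>n. n \<ge> N \<Longrightarrow>
        \<bar>measure_pmf.prob (p n) (B \<inter> K) - measure_pmf.prob q (B \<inter> K)\<bar> < e / 4"
      using LIMSEQ_D[of _ _ "e / 4"] \<open>e > 0\<close> by (metis divide_pos_pos real_norm_def zero_less_numeral)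
    have "\<bar>measure_pmf.prob (p n) B - measure_pmf.prob q B\<bar> < e" if "n \<ge> N" for n
      using N[OF that] split[of "p n"] split[of q] K(3)[of n] qK \<open>e > 0\<close> by linarith
    thus "\<exists>N. \<forall>n\<ge>N. norm (measure_pmf.prob (p n) B - measure_pmf.prob q B) < e"
      by auto
  qed
  thus ?thesis by blast
qed

text \<open>
  A form of Prokhorov's theorem for discrete distributions on a countable product: if every coordinate is
  tight, a subsequence converges on all events that depend on finitely many coordinates. The limits
  of the finite-dimensional distributions are consistent, and the Daniell-Kolmogorov theorem joins
  them to one measure.
\<close>

lemma tight_product_pmf_subsequence:
  fixes p :: "nat \<Rightarrow> ('i \<Rightarrow> 'a :: polish_space) pmf" and I :: "'i set"
  assumes I: "countable I"
    and tight: "\<And>i \<epsilon>. i \<in> I \<Longrightarrow> \<epsilon> > 0 \<Longrightarrow>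
      \<exists>K. finite K \<and> (\<forall>n. measure_pmf.prob (p n) {\<omega>. \<omega> i \<notin> K} \<le> \<epsilon>)"
  shows "\<exists>P r. prob_space P \<and> sets P = sets (PiM I (\<lambda>_. borel)) \<and> strict_mono (r :: nat \<Rightarrow> nat) \<and>
    (\<forall>J Q. finite J \<longrightarrow> J \<subseteq> I \<longrightarrow> Measurable.pred (PiM J (\<lambda>_. borel)) Q \<longrightarrow>
       (\<forall>\<omega>. Q (restrict \<omega> J) = Q \<omega>) \<longrightarrow>
       (\<lambda>n. measure_pmf.prob (p (r n)) {\<omega>. Q \<omega>}) \<longlonglongrightarrow> measure P {\<omega> \<in> space P. Q \<omega>})"
proof -
  let ?m = "\<lambda>J. map_pmf (\<lambda>\<omega>. restrict \<omega> J)"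
  \<comment> \<open>Discrete distributions have countable support, so only countably many finite-dimensional
    weights are not constantly \<open>0\<close>.\<close>
  define S where
    "S = (SIGMA J:{J. finite J \<and> J \<subseteq> I}. (\<lambda>\<omega>. restrict \<omega> J) ` (\<Union>n. set_pmf (p n)))"
  have "countable {J. finite J \<and> J \<subseteq> I}"
    using I by (rule countable_Collect_finite_subset)
  hence "countable S"
    unfolding S_def by (intro countable_SIGMA countable_image countable_UN) auto
  then obtain r :: "nat \<Rightarrow> nat" where r: "strict_mono r"
    and lim: "\<And>x. x \<in> S \<Longrightarrow> \<exists>l. (\<lambda>n. pmf (?m (fst x) (p (r n))) (snd x)) \<longlonglongrightarrow> l"
    using function_convergent_subsequence[of S "\<lambda>n x. pmf (?m (fst x) (p n)) (snd x)" 1]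
    by (auto simp: pmf_le_1)
  have "\<exists>q. \<forall>B. (\<lambda>n. measure_pmf.prob (?m J (p (r n))) B) \<longlonglongrightarrow> measure_pmf.prob q B"
    if J: "finite J" "J \<subseteq> I" for J
  proof (rule tight_pmf_limit)
    fix f
    show "convergent (\<lambda>n. pmf (?m J (p (r n))) f)"
    proof (cases "(J, f) \<in> S")
      case True
      thus ?thesis using lim[of "(J, f)"] by (auto simp: convergent_def)
    next
      case False
      hence "pmf (?m J (p (r n))) f = 0" for n
        using J by (intro pmf_map_outside) (auto simp: S_def)
      thus ?thesis by (simp add: convergent_const)
    qed
  next
    fix \<epsilon> :: real assume "\<epsilon> > 0"
    hence "\<epsilon> / (card J + 1) > 0" by (simp add: add_pos_nonneg)
    hence "\<forall>i\<in>J. \<exists>K. finite K \<and> (\<forall>n. measure_pmf.prob (p n) {\<omega>. \<omega> i \<notin> K} \<le> \<epsilon> / (card J + 1))"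
      using tight J by blast
    then obtain K where K: "\<And>i. i \<in> J \<Longrightarrow> finite (K i)"
      "\<And>i n. i \<in> J \<Longrightarrow> measure_pmf.prob (p n) {\<omega>. \<omega> i \<notin> K i} \<le> \<epsilon> / (card J + 1)"
      by metis
    have "measure_pmf.prob (?m J (p (r n))) (- PiE J K) \<le> \<epsilon>" for n
    proof -
      have "measure_pmf.prob (?m J (p (r n))) (- PiE J K)
          = measure_pmf.prob (p (r n)) (\<Union>i\<in>J. {\<omega>. \<omega> i \<notin> K i})"
        unfolding measure_map_pmf by (rule arg_cong[where f = "measure_pmf.prob _"]) auto
      also have "\<dots> \<le> (\<Sum>i\<in>J. measure_pmf.prob (p (r n)) {\<omega>. \<omega> i \<notin> K i})"
        by (rule measure_pmf.finite_measure_subadditive_finite) (use J in auto)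
      also have "\<dots> \<le> (\<Sum>i\<in>J. \<epsilon> / (card J + 1))"
        by (intro sum_mono K)
      also have "\<dots> \<le> \<epsilon>" using \<open>\<epsilon> > 0\<close> by (simp add: field_simps)
      finally show ?thesis .
    qed
    thus "\<exists>K. finite K \<and> (\<forall>n. measure_pmf.prob (?m J (p (r n))) (- K) \<le> \<epsilon>)"
      using J K(1) by (intro exI[of _ "PiE J K"]) (auto intro: finite_PiE)
  qed
  then obtain q where q: "\<And>J B. finite J \<Longrightarrow> J \<subseteq> I \<Longrightarrow>
      (\<lambda>n. measure_pmf.prob (?m J (p (r n))) B) \<longlonglongrightarrow> measure_pmf.prob (q J) B"
    by metis
  have proj: "?m J (q H) = q J" if "J \<subseteq> H" "finite H" "H \<subseteq> I" for J H
  proof (rule pmf_eqI)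
    fix f
    have J: "finite J" "J \<subseteq> I" using that finite_subset by auto
    have "(\<lambda>n. measure_pmf.prob (?m H (p (r n))) {g. restrict g J = f})
        \<longlonglongrightarrow> measure_pmf.prob (q H) {g. restrict g J = f}"
      using that by (intro q) auto
    moreover have "measure_pmf.prob (?m H (p (r n))) {g. restrict g J = f}
        = measure_pmf.prob (?m J (p (r n))) {f}" for n
      using that(1) by (auto intro!: arg_cong[where f = "measure_pmf.prob _"] simp: Int_absorb1)
    ultimately have "measure_pmf.prob (q H) {g. restrict g J = f} = measure_pmf.prob (q J) {f}"
      using q[OF J, of "{f}"] by (auto intro: LIMSEQ_unique)
    moreover have "pmf (?m J (q H)) f = measure_pmf.prob (q H) {g. restrict g J = f}"
      by (auto simp: pmf_map intro!: arg_cong[where f = "measure_pmf.prob _"])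
    ultimately show "pmf (?m J (q H)) f = pmf (q J) f"
      by (simp add: measure_pmf_single)
  qed
  define P where "P J = distr (measure_pmf (q J)) (PiM J (\<lambda>_. borel)) (\<lambda>f. restrict f J)" for J
  have meas: "(\<lambda>f. restrict f J) \<in> measure_pmf s \<rightarrow>\<^sub>M PiM J (\<lambda>_. borel :: 'a measure)" for J s
    by (auto simp: space_PiM)
  interpret polish_projective I P
  proof (intro polish_projective.intro projective_family.intro)
    fix J H assume *: "J \<subseteq> H" "finite H" "H \<subseteq> I"
    have "P J = distr (distr (measure_pmf (q H)) (count_space UNIV) (\<lambda>f. restrict f J))
        (PiM J (\<lambda>_. borel)) (\<lambda>f. restrict f J)"
      unfolding P_def proj[OF *, symmetric] map_pmf_rep_eq ..
    also have "\<dots> = distr (measure_pmf (q H)) (PiM J (\<lambda>_. borel)) (\<lambda>f. restrict f J)"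
      by (subst distr_distr) (auto simp: space_PiM comp_def)
    also have "\<dots> = distr (P H) (PiM J (\<lambda>_. borel)) (\<lambda>f. restrict f J)"
      unfolding P_def using *(1)
      by (subst distr_distr) (auto simp: space_PiM comp_def Int_absorb1 intro!: measurable_restrict_subset)
    finally show "P J = distr (P H) (PiM J (\<lambda>_. borel)) (\<lambda>f. restrict f J)" .
  next
    fix J assume "finite J" "J \<subseteq> I"
    show "prob_space (P J)"
      unfolding P_def by (rule measure_pmf.prob_space_distr[OF meas])
  qed
  have conv: "(\<lambda>n. measure_pmf.prob (p (r n)) {\<omega>. Q \<omega>}) \<longlonglongrightarrow> measure lim {\<omega> \<in> space lim. Q \<omega>}"
    if J: "finite J" "J \<subseteq> I" and Q: "Measurable.pred (PiM J (\<lambda>_. borel)) Q"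
      and dep: "\<And>\<omega>. Q (restrict \<omega> J) = Q \<omega>" for J Q
  proof -
    let ?B = "{f \<in> space (PiM J (\<lambda>_. borel :: 'a measure)). Q f}"
    have B: "?B \<in> sets (PiM J (\<lambda>_. borel))" using Q by (rule predE)
    have "{\<omega> \<in> space lim. Q \<omega>} = emb I J ?B"
      using J dep by (auto simp: prod_emb_def space_PiM)
    hence "measure lim {\<omega> \<in> space lim. Q \<omega>} = measure (P J) ?B"
      using measure_lim_emb[OF J(2,1) B] by simp
    also have "\<dots> = measure_pmf.prob (q J) {f. Q f}"
      unfolding P_def by (subst measure_distr[OF meas B])
        (auto simp: space_PiM dep intro!: arg_cong[where f = "measure_pmf.prob _"])
    finally show ?thesis
      using q[OF J, of "{f. Q f}"] by (simp add: dep vimage_def)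
  qed
  show ?thesis
    by (rule exI[of _ lim], rule exI[of _ r]) (use r conv P.prob_space_axioms in auto)
qed

section \<open>Limits of random permutations of a countable set\<close>

lemma cylinders_subset: "{cylinder A x y |x y. x \<in> A \<and> y \<in> A} \<subseteq> Pow (perms A)"
  by (auto simp: cylinder_def)

lemma space_perm_space: "space (perm_space A) = perms A"
  unfolding perm_space_def by (rule space_measure_of[OF cylinders_subset])

lemma cylinder_semiring_sets:
  assumes "B \<in> cylinder_semiring A"
  shows "B \<in> sets (perm_space A)"
proof -
  obtain F G where FG: "finite F" "finite G" "F \<subseteq> A \<times> A" "G \<subseteq> A \<times> A" and
    B: "B = {\<pi> \<in> perms A. (\<forall>(x, y)\<in>F. \<pi> \<in> cylinder A x y) \<and> (\<forall>(x, y)\<in>G. \<pi> \<notin> cylinder A x y)}"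
    using assms unfolding cylinder_semiring_def by blast
  have cyl: "{\<pi> \<in> space (perm_space A). \<pi> \<in> cylinder A x y} \<in> sets (perm_space A)"
    if "(x, y) \<in> A \<times> A" for x y
  proof -
    have "cylinder A x y \<in> sets (perm_space A)"
      unfolding perm_space_def using that by (subst sets_measure_of[OF cylinders_subset]) auto
    moreover have "{\<pi> \<in> space (perm_space A). \<pi> \<in> cylinder A x y} = cylinder A x y"
      by (auto simp: space_perm_space cylinder_def)
    ultimately show ?thesis by simp
  qed
  have "B = {\<pi> \<in> space (perm_space A). (\<forall>z\<in>F. \<pi> \<in> cylinder A (fst z) (snd z)) \<and>
                                     (\<forall>z\<in>G. \<not> \<pi> \<in> cylinder A (fst z) (snd z))}"
    unfolding B space_perm_space by auto
  also have "\<dots> \<in> sets (perm_space A)"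
    by (intro sets.sets_Collect_conj sets.sets_Collect_finite_All sets.sets_Collect_neg cyl)
       (use FG in auto)
  finally show ?thesis .
qed

text \<open>
  Compactness for random permutations of a countable set. Tightness of the images alone would give a
  limit that is only an injective map almost surely, so the limit is taken for the images and the preimages
  jointly: the relation \<open>\<pi> x = y \<longleftrightarrow> inv \<pi> y = x\<close> involves only two coordinates and survives.
\<close>

lemma tight_perms_subsequence:
  fixes \<mu> :: "nat \<Rightarrow> ('a :: polish_space \<Rightarrow> 'a) pmf" and A :: "'a set"
  assumes A: "countable A"
    and perms: "\<And>n. set_pmf (\<mu> n) \<subseteq> perms A"
    and tight: "\<And>x \<epsilon>. x \<in> A \<Longrightarrow> \<epsilon> > 0 \<Longrightarrow>
      \<exists>K. finite K \<and> (\<forall>n. measure_pmf.prob (\<mu> n) {\<pi>. \<pi> x \<notin> K} \<le> \<epsilon>)"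
    and tight_inv: "\<And>x \<epsilon>. x \<in> A \<Longrightarrow> \<epsilon> > 0 \<Longrightarrow>
      \<exists>K. finite K \<and> (\<forall>n. measure_pmf.prob (\<mu> n) {\<pi>. inv \<pi> x \<notin> K} \<le> \<epsilon>)"
  obtains P r where "prob_space P" "sets P = sets (perm_space A)" "strict_mono (r :: nat \<Rightarrow> nat)"
    "\<And>B. B \<in> cylinder_semiring A \<Longrightarrow> (\<lambda>n. measure_pmf.prob (\<mu> (r n)) B) \<longlonglongrightarrow> measure P B"
proof -
  define c :: "('a \<Rightarrow> 'a) \<Rightarrow> 'a \<times> bool \<Rightarrow> 'a"
    where "c \<pi> = (\<lambda>(x, b). if b then \<pi> x else inv \<pi> x)" for \<pi>
  define I where "I = A \<times> (UNIV :: bool set)"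
  have I: "countable I" unfolding I_def using A by auto
  have tight_c: "\<exists>K. finite K \<and> (\<forall>n. measure_pmf.prob (map_pmf c (\<mu> n)) {\<omega>. \<omega> i \<notin> K} \<le> \<epsilon>)"
    if "i \<in> I" "\<epsilon> > 0" for i \<epsilon>
    using that tight[of "fst i" \<epsilon>] tight_inv[of "fst i" \<epsilon>]
    by (cases i; cases "snd i") (auto simp: I_def c_def vimage_def)
  have ex: "\<exists>M r. prob_space M \<and> sets M = sets (PiM I (\<lambda>_. borel)) \<and> strict_mono (r :: nat \<Rightarrow> nat) \<and>
    (\<forall>J Q. finite J \<longrightarrow> J \<subseteq> I \<longrightarrow> Measurable.pred (PiM J (\<lambda>_. borel)) Q \<longrightarrow>
       (\<forall>\<omega>. Q (restrict \<omega> J) = Q \<omega>) \<longrightarrow>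
       (\<lambda>n. measure_pmf.prob (map_pmf c (\<mu> (r n))) {\<omega>. Q \<omega>}) \<longlonglongrightarrow> measure M {\<omega> \<in> space M. Q \<omega>})"
    by (rule tight_product_pmf_subsequence[OF I]) (rule tight_c)
  obtain M r where M: "prob_space M" "sets M = sets (PiM I (\<lambda>_. borel))" and r: "strict_mono (r :: nat \<Rightarrow> nat)"
    and lim': "\<forall>J Q. finite J \<longrightarrow> J \<subseteq> I \<longrightarrow> Measurable.pred (PiM J (\<lambda>_. borel)) Q \<longrightarrow>
       (\<forall>\<omega>. Q (restrict \<omega> J) = Q \<omega>) \<longrightarrow>
       (\<lambda>n. measure_pmf.prob (map_pmf c (\<mu> (r n))) {\<omega>. Q \<omega>}) \<longlonglongrightarrow> measure M {\<omega> \<in> space M. Q \<omega>}"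
    using ex by (elim exE conjE) (rule that)
  have lim: "(\<lambda>n. measure_pmf.prob (map_pmf c (\<mu> (r n))) {\<omega>. Q \<omega>}) \<longlonglongrightarrow> measure M {\<omega> \<in> space M. Q \<omega>}"
    if "finite J" "J \<subseteq> I" "Measurable.pred (PiM J (\<lambda>_. borel)) Q" "\<And>\<omega>. Q (restrict \<omega> J) = Q \<omega>" for J Q
    using lim' that by simp
  interpret M: prob_space M by fact
  note [measurable_cong] = M(2)
  have [measurable]: "A \<in> sets borel"
    using A by (rule sets.countable[rotated]) auto
  have comp: "(\<lambda>\<omega>. \<omega> i) \<in> borel_measurable (PiM J (\<lambda>_. borel))" if "i \<in> J" for i :: "'a \<times> bool" and J
    using that by (rule measurable_component_singleton)
  have eq_pred: "Measurable.pred (PiM J (\<lambda>_. borel)) (\<lambda>\<omega>. \<omega> i = y)"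
    if "i \<in> J" for i :: "'a \<times> bool" and J and y :: 'a
    using comp[OF that] by measurable
  have lim_AE: "AE \<omega> in M. Q \<omega>"
    if J: "finite J" "J \<subseteq> I" and Q: "Measurable.pred (PiM J (\<lambda>_. borel)) Q"
      and QI: "Measurable.pred (PiM I (\<lambda>_. borel)) Q"
      and dep: "\<And>\<omega>. Q (restrict \<omega> J) = Q \<omega>"
      and holds: "\<And>\<pi>. \<pi> permutes A \<Longrightarrow> Q (c \<pi>)" for J Q
  proof -
    have "measure_pmf.prob (map_pmf c (\<mu> (r n))) {\<omega>. Q \<omega>} = 1" for n
      using perms[of "r n"] holds by (auto simp: measure_pmf.prob_eq_1 AE_measure_pmf_iff perms_def)
    hence "measure M {\<omega> \<in> space M. Q \<omega>} = 1"
      using lim[OF J Q dep] by (simp add: LIMSEQ_const_iff)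
    moreover have "Measurable.pred M Q" using QI by measurable
    ultimately show ?thesis
      by (subst (asm) M.prob_Collect_eq_1) auto
  qed
  have AE1: "AE \<omega> in M. \<omega> (x, b) \<in> A" if "x \<in> A" for x b
    by (rule lim_AE[of "{(x, b)}"])
       (use that in \<open>auto simp: I_def c_def permutes_in_image permutes_inv intro!: measurable_compose[OF comp]\<close>)
  have AE2: "AE \<omega> in M. \<omega> (x, True) = y \<longleftrightarrow> \<omega> (y, False) = x" if "x \<in> A" "y \<in> A" for x y
    by (rule lim_AE[of "{(x, True), (y, False)}"])
       (use that in \<open>auto simp: I_def c_def permutes_inverses intro!: pred_intros_logic eq_pred\<close>)
  \<comment> \<open>The limit lives on all functions of the joint index; almost surely it comes from a permutation.\<close>
  define good where "good \<omega> \<longleftrightarrow> (\<forall>x\<in>A. \<omega> (x, True) \<in> A \<and> \<omega> (x, False) \<in> A \<and>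
      (\<forall>y\<in>A. \<omega> (x, True) = y \<longleftrightarrow> \<omega> (y, False) = x))" for \<omega> :: "'a \<times> bool \<Rightarrow> 'a"
  have AE_good: "AE \<omega> in M. good \<omega>"
    unfolding good_def using A AE1 AE2 by (auto simp: AE_ball_countable)
  have good_meas: "Measurable.pred (PiM I (\<lambda>_. borel)) good"
    unfolding good_def using A
    by (auto intro!: pred_intros_countable_bounded pred_intros_logic eq_pred measurable_compose[OF comp] simp: I_def)
  define \<Phi> where "\<Phi> \<omega> = (if good \<omega> then (\<lambda>x. if x \<in> A then \<omega> (x, True) else x) else id)"
    for \<omega> :: "'a \<times> bool \<Rightarrow> 'a"
  have \<Phi>_perm: "\<Phi> \<omega> permutes A" for \<omega>
  proof (cases "good \<omega>")
    case True
    show ?thesis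
    proof (rule bij_imp_permutes)
      show "bij_betw (\<Phi> \<omega>) A A"
        by (rule bij_betw_byWitness[where f' = "\<lambda>x. \<omega> (x, False)"])
           (use True in \<open>auto simp: \<Phi>_def good_def\<close>)
    qed (use True in \<open>auto simp: \<Phi>_def\<close>)
  qed (simp add: \<Phi>_def permutes_id)
  have \<Phi>: "\<Phi> \<in> M \<rightarrow>\<^sub>M perm_space A"
    unfolding perm_space_def
  proof (rule measurable_measure_of[OF cylinders_subset])
    show "\<Phi> \<in> space M \<rightarrow> perms A" using \<Phi>_perm by (auto simp: perms_def)
    fix C assume "C \<in> {cylinder A x y |x y. x \<in> A \<and> y \<in> A}"
    then obtain x y where xy: "x \<in> A" "y \<in> A" and C: "C = cylinder A x y" by blast
    have "\<Phi> -` C \<inter> space M = {\<omega> \<in> space M. if good \<omega> then \<omega> (x, True) = y else x = y}"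
      unfolding C cylinder_def using \<Phi>_perm xy by (auto simp: perms_def \<Phi>_def)
    also have "\<dots> \<in> sets M"
    proof -
      have "Measurable.pred (PiM I (\<lambda>_. borel)) (\<lambda>\<omega>. if good \<omega> then \<omega> (x, True) = y else x = y)"
        using good_meas eq_pred[of "(x, True)" I y] xy by (auto simp: I_def)
      hence "Measurable.pred M (\<lambda>\<omega>. if good \<omega> then \<omega> (x, True) = y else x = y)"
        by measurable
      thus ?thesis by (rule predE)
    qed
    finally show "\<Phi> -` C \<inter> space M \<in> sets M" .
  qed
  define P where "P = distr M (perm_space A) \<Phi>"
  have P: "prob_space P" unfolding P_def by (rule M.prob_space_distr[OF \<Phi>])
  have "(\<lambda>n. measure_pmf.prob (\<mu> (r n)) B) \<longlonglongrightarrow> measure P B" if B: "B \<in> cylinder_semiring A" for B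
  proof -
    obtain F G where FG: "finite F" "finite G" "F \<subseteq> A \<times> A" "G \<subseteq> A \<times> A" and
      B_eq: "B = {\<pi> \<in> perms A. (\<forall>(x, y)\<in>F. \<pi> \<in> cylinder A x y) \<and> (\<forall>(x, y)\<in>G. \<pi> \<notin> cylinder A x y)}"
      using B unfolding cylinder_semiring_def by blast
    define Q where "Q \<omega> \<longleftrightarrow> (\<forall>z\<in>F. \<omega> (fst z, True) = snd z) \<and> (\<forall>z\<in>G. \<omega> (fst z, True) \<noteq> snd z)"
      for \<omega> :: "'a \<times> bool \<Rightarrow> 'a"
    define J where "J = fst ` (F \<union> G) \<times> {True}"
    have J: "finite J" "J \<subseteq> I" using FG by (auto simp: J_def I_def)
    have Q_meas: "Measurable.pred (PiM H (\<lambda>_. borel)) Q" if "J \<subseteq> H" for H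
      unfolding Q_def using FG that
      by (auto intro!: pred_intros_finite pred_intros_logic eq_pred simp: J_def)
    have dep: "Q (restrict \<omega> J) = Q \<omega>" for \<omega>
      by (auto simp: Q_def J_def)
    have Q_c: "Q (c \<pi>) \<longleftrightarrow> \<pi> \<in> B" if "\<pi> \<in> perms A" for \<pi>
      using that by (auto simp: B_eq Q_def c_def cylinder_def split: prod.splits)
    have "measure_pmf.prob (map_pmf c (\<mu> (r n))) {\<omega>. Q \<omega>} = measure_pmf.prob (\<mu> (r n)) B" for n
      unfolding measure_map_pmf vimage_def using perms[of "r n"] Q_c
      by (intro measure_pmf.finite_measure_eq_AE AE_pmfI) auto
    moreover have "measure M {\<omega> \<in> space M. Q \<omega>} = measure P B"
    proof -
      have B_sets: "B \<in> sets (perm_space A)"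
        using B by (rule cylinder_semiring_sets)
      have "Measurable.pred M Q" using Q_meas[OF J(2)] by measurable
      hence "measure M {\<omega> \<in> space M. Q \<omega>} = measure M (\<Phi> -` B \<inter> space M)"
      proof (intro M.finite_measure_eq_AE measurable_sets[OF \<Phi> B_sets] predE)
        show "AE \<omega> in M. \<omega> \<in> {\<omega> \<in> space M. Q \<omega>} \<longleftrightarrow> \<omega> \<in> \<Phi> -` B \<inter> space M"
          using AE_good
        proof eventually_elim
          case (elim \<omega>)
          have "\<Phi> \<omega> \<in> B \<longleftrightarrow> Q \<omega>"
            using \<Phi>_perm[of \<omega>] elim FG
            by (fastforce simp: B_eq Q_def \<Phi>_def cylinder_def perms_def)
          thus ?case by auto
        qed
      qed
      also have "\<dots> = measure P B"
        unfolding P_def by (rule measure_distr[OF \<Phi> B_sets, symmetric])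
      finally show ?thesis .
    qed
    ultimately show ?thesis
      using lim[OF J Q_meas[OF order_refl] dep] by simp
  qed
  with P r show thesis
    by (intro that[of P r]) (auto simp: P_def)
qed

section \<open>Periodic lattices\<close>

lemma int_box_eq: "int_box L = {- int (L div 2) ..< int L - int (L div 2)}"
proof -
  have "- real L / 2 \<le> of_int z \<longleftrightarrow> - int L \<le> 2 * z" for z
  proof -
    have "- real L / 2 \<le> of_int z \<longleftrightarrow> real_of_int (- int L) \<le> real_of_int (2 * z)" by auto
    thus ?thesis by (simp only: of_int_le_iff)
  qed
  moreover have "of_int z < real L / 2 \<longleftrightarrow> 2 * z < int L" for z
  proof -
    have "of_int z < real L / 2 \<longleftrightarrow> real_of_int (2 * z) < real_of_int (int L)" by auto
    thus ?thesis by (simp only: of_int_less_iff)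
  qed
  ultimately show ?thesis
    unfolding int_box_def by (auto simp: zdiv_int)
qed

text \<open>The representative of \<open>z\<close> modulo \<open>L\<close> in \<^term>\<open>int_box L\<close>.\<close>

definition int_per :: "nat \<Rightarrow> int \<Rightarrow> int" where
  "int_per L z = (z + int (L div 2)) mod int L - int (L div 2)"

lemma int_per_in_box: "L \<ge> 1 \<Longrightarrow> int_per L z \<in> int_box L"
  unfolding int_per_def int_box_eq by simp

lemma int_per_self: "z \<in> int_box L \<Longrightarrow> int_per L z = z"
  unfolding int_per_def int_box_eq by simp

lemma int_per_mod: "int_per L z mod int L = z mod int L"
  unfolding int_per_def by (simp add: mod_simps)

lemma int_per_cong: "a mod int L = b mod int L \<Longrightarrow> int_per L a = int_per L b"
  unfolding int_per_def by (metis mod_add_left_eq)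

lemma int_per_add_int_per: "int_per L (int_per L a + b) = int_per L (a + b)"
  by (rule int_per_cong) (metis int_per_mod mod_add_left_eq)

lemma int_per_diff_int_per: "int_per L (int_per L a - int_per L b) = int_per L (a - b)"
  by (rule int_per_cong) (metis int_per_mod mod_diff_eq)

lemma int_per_diff_eq:
  assumes "z \<in> int_box L" "w \<in> int_box L"
  shows "int_per_diff L z w = int_per L (z - w)"
proof -
  have box: "- int (L div 2) \<le> z" "z < int L - int (L div 2)" "- int (L div 2) \<le> w" "w < int L - int (L div 2)"
    using assms by (auto simp: int_box_eq)
  have "L \<ge> 1" using box by linarith
  have lower: "of_int (z - w) \<in> {- real L ..< - real L / 2} \<longleftrightarrow> z - w < - int (L div 2)"
  proof -
    have "real_of_int (- int L) \<le> real_of_int (z - w)"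
      unfolding of_int_le_iff using box by linarith
    hence "of_int (z - w) \<in> {- real L ..< - real L / 2}
        \<longleftrightarrow> real_of_int (2 * (z - w)) < real_of_int (- int L)" by auto
    also have "\<dots> \<longleftrightarrow> 2 * (z - w) < - int L" by (simp only: of_int_less_iff)
    also have "\<dots> \<longleftrightarrow> z - w < - int (L div 2)" unfolding zdiv_int by auto
    finally show ?thesis .
  qed
  show ?thesis
  proof (cases "z - w \<in> int_box L")
    case True
    thus ?thesis by (simp add: int_per_diff_def int_per_self)
  next
    case False
    define s where "s = (if z - w < - int (L div 2) then z - w + int L else z - w - int L)"
    have "s \<in> int_box L"
      using False box by (auto simp: s_def int_box_eq)
    hence "s = int_per L s" by (simp add: int_per_self)
    also have "\<dots> = int_per L (z - w)"
      by (rule int_per_cong) (simp add: s_def)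
    finally show ?thesis
      unfolding int_per_diff_def using False lower by (simp add: s_def)
  qed
qed

lemma int_per_diff_same: "L \<ge> 1 \<Longrightarrow> int_per_diff L z z = 0"
  by (simp add: int_per_diff_def int_box_def)

text \<open>
  Reduction modulo \<open>L\<close> is not odd: for even \<open>L\<close> the point \<open>- L / 2\<close> represents its own negative. Only
  the absolute values agree.
\<close>

lemma abs_int_per_minus:
  assumes "L \<ge> 1"
  shows "\<bar>int_per L (- u)\<bar> = \<bar>int_per L u\<bar>"
proof -
  define r where "r = int_per L u"
  have r: "- int (L div 2) \<le> r" "r < int L - int (L div 2)"
    using int_per_in_box[OF assms, of u] by (auto simp: r_def int_box_eq)
  have eq: "int_per L (- u) = int_per L (- r)"
    by (rule int_per_cong) (metis int_per_mod mod_minus_eq r_def)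
  show ?thesis
  proof (cases "- r \<in> int_box L")
    case True
    thus ?thesis by (simp add: eq int_per_self flip: r_def)
  next
    case False
    have "int L \<le> 2 * int (L div 2) + 1" by linarith
    hence *: "r = - int (L div 2)" "int L = 2 * int (L div 2)"
      using r False by (auto simp: int_box_eq)
    have "- r mod int L = r mod int L"
      using * by (metis add.inverse_inverse minus_mod_self2 mod_minus_eq mult_2 diff_minus_eq_add add_diff_cancel_left' minus_add_distrib mod_add_self2)
    hence "int_per L (- r) = int_per L r" by (rule int_per_cong)
    also have "\<dots> = r" using r by (intro int_per_self) (auto simp: int_box_eq)
    finally show ?thesis by (simp add: eq flip: r_def)
  qed
qed

lemma abs_int_per_le:
  assumes "L \<ge> 1"
  shows "\<bar>int_per L u\<bar> \<le> \<bar>u\<bar>"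
proof (cases "u \<in> int_box L")
  case True
  thus ?thesis by (simp add: int_per_self)
next
  case False
  have "int L \<le> 2 * int (L div 2) + 1" by linarith
  thus ?thesis using False int_per_in_box[OF assms, of u] by (auto simp: int_box_eq)
qed

text \<open>The integer coordinates of a lattice point.\<close>

abbreviation coords :: "('d::finite \<Rightarrow> real^'d) \<Rightarrow> real^'d \<Rightarrow> 'd \<Rightarrow> int" where
  "coords v \<equiv> inv (lattice_point v)"

lemma inj_lattice_point:
  assumes "lattice_basis v"
  shows "inj (lattice_point v)"
proof (rule injI)
  fix z w :: "'a \<Rightarrow> int" assume eq: "lattice_point v z = lattice_point v w"
  have v: "inj v" "independent (range v)" using assms by (auto simp: lattice_basis_def)
  define u where "u x = real_of_int (z (inv v x) - w (inv v x))" for x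
  have "(\<Sum>x\<in>range v. u x *\<^sub>R x) = (\<Sum>i\<in>UNIV. of_int (z i - w i) *\<^sub>R v i)"
    using v(1) by (simp add: sum.reindex u_def)
  also have "\<dots> = lattice_point v z - lattice_point v w"
    by (simp add: lattice_point_def scaleR_diff_left sum_subtractf)
  also have "\<dots> = 0" using eq by simp
  finally have "u (v i) = 0" for i
    using independentD[OF v(2), of "range v" u "v i"] by auto
  thus "z = w" using v(1) by (auto simp: u_def fun_eq_iff)
qed

lemma norm_lattice_point_le:
  assumes "\<And>i. \<bar>z i\<bar> \<le> R"
  shows "norm (lattice_point v z) \<le> of_int R * (\<Sum>i\<in>UNIV. norm (v i))"
proof -
  have "norm (lattice_point v z) \<le> (\<Sum>i\<in>UNIV. norm (of_int (z i) *\<^sub>R v i))"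
    unfolding lattice_point_def by (rule norm_sum)
  also have "\<dots> \<le> (\<Sum>i\<in>UNIV. of_int R * norm (v i))"
    using assms by (intro sum_mono) (auto intro!: mult_right_mono simp flip: of_int_abs)
  finally show ?thesis by (simp add: sum_distrib_left)
qed

lemma finite_lattice_box: "finite {z :: 'd :: finite \<Rightarrow> int. \<forall>i. z i \<in> B i}" if "\<And>i. finite (B i)"
proof -
  have "{z :: 'd \<Rightarrow> int. \<forall>i. z i \<in> B i} = PiE UNIV B" by (auto simp: PiE_UNIV_domain)
  thus ?thesis using that by (simp add: finite_PiE)
qed

lemma finite_periodic_lattice: "finite (periodic_lattice v L)"
proof -
  have "periodic_lattice v L = lattice_point v ` {z. \<forall>i. z i \<in> int_box L}"
    by (auto simp: periodic_lattice_def)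
  moreover have "finite (int_box L)" by (simp add: int_box_eq)
  ultimately show ?thesis by (simp add: finite_lattice_box)
qed

lemma periodic_lattice_subset: "periodic_lattice v L \<subseteq> regular_lattice v"
  by (auto simp: periodic_lattice_def regular_lattice_def)

lemma countable_regular_lattice: "countable (regular_lattice v)"
  unfolding regular_lattice_def by simp

lemma per_diff_in_lattice: "per_diff v L x y \<in> regular_lattice v"
  by (simp add: per_diff_def regular_lattice_def)

lemma per_diff_same: "L \<ge> 1 \<Longrightarrow> per_diff v L x x = 0"
  by (simp add: per_diff_def int_per_diff_same lattice_point_def)

context
  fixes v :: "'d::finite \<Rightarrow> real^'d"
  assumes basis: "lattice_basis v"
begin

lemma coords_lattice_point [simp]: "coords v (lattice_point v z) = z"
  by (rule inv_f_f[OF inj_lattice_point[OF basis]])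

lemma coords_box: "x \<in> periodic_lattice v L \<Longrightarrow> coords v x i \<in> int_box L"
  by (auto simp: periodic_lattice_def)

lemma lattice_point_coords: "x \<in> regular_lattice v \<Longrightarrow> lattice_point v (coords v x) = x"
  by (auto simp: regular_lattice_def)

lemma coords_per_diff:
  assumes "x \<in> periodic_lattice v L" "y \<in> periodic_lattice v L"
  shows "coords v (per_diff v L x y) i = int_per L (coords v x i - coords v y i)"
  using assms by (simp add: per_diff_def int_per_diff_eq coords_box)

lemma per_diff_eqI:
  assumes "x \<in> periodic_lattice v L" "y \<in> periodic_lattice v L"
    and "x' \<in> periodic_lattice v L" "y' \<in> periodic_lattice v L"
    and "\<And>i. int_per L (coords v x i - coords v y i) = int_per L (coords v x' i - coords v y' i)"
  shows "per_diff v L x y = per_diff v L x' y'"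
  using assms by (simp add: per_diff_def int_per_diff_eq coords_box)

text \<open>Translations of the torus act transitively and preserve the periodic difference.\<close>

lemma ex_periodic_translation:
  assumes L: "L \<ge> 1" and x: "x \<in> periodic_lattice v L" "x' \<in> periodic_lattice v L"
  shows "\<exists>\<tau>. \<tau> permutes periodic_lattice v L \<and> \<tau> x = x' \<and>
    (\<forall>y\<in>periodic_lattice v L. \<forall>z\<in>periodic_lattice v L. per_diff v L (\<tau> y) (\<tau> z) = per_diff v L y z)"
proof -
  let ?A = "periodic_lattice v L"
  define t where "t a y = lattice_point v (\<lambda>i. int_per L (coords v y i + a i))" for a y
  define a where "a i = coords v x' i - coords v x i" for i
  define \<tau> where "\<tau> y = (if y \<in> ?A then t a y else y)" for y
  have t_in: "t b y \<in> ?A" for b y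
    unfolding t_def periodic_lattice_def using int_per_in_box[OF L] by blast
  have t_inv: "t (\<lambda>i. - b i) (t b y) = y" "t b (t (\<lambda>i. - b i) y) = y" if "y \<in> ?A" for b y
  proof -
    have "y = lattice_point v (coords v y)"
      using that periodic_lattice_subset by (subst lattice_point_coords) auto
    thus "t (\<lambda>i. - b i) (t b y) = y" "t b (t (\<lambda>i. - b i) y) = y"
      using that int_per_add_int_per[of L _ "- b _"] int_per_add_int_per[of L _ "b _"]
      by (simp_all add: t_def int_per_self coords_box)
  qed
  have "\<tau> permutes ?A"
  proof (rule bij_imp_permutes)
    show "bij_betw \<tau> ?A ?A"
      by (rule bij_betw_byWitness[where f' = "t (\<lambda>i. - a i)"]) (auto simp: \<tau>_def t_in t_inv)
  qed (simp add: \<tau>_def)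
  moreover have "\<tau> x = x'"
  proof -
    have "x' = lattice_point v (coords v x')"
      using x periodic_lattice_subset by (subst lattice_point_coords) auto
    thus ?thesis using x by (simp add: \<tau>_def t_def a_def int_per_self coords_box)
  qed
  moreover have "per_diff v L (\<tau> y) (\<tau> z) = per_diff v L y z" if "y \<in> ?A" "z \<in> ?A" for y z
  proof (rule per_diff_eqI)
    show "\<tau> y \<in> ?A" "\<tau> z \<in> ?A" using that by (simp_all add: \<tau>_def t_in)
  qed (use that in \<open>simp_all add: \<tau>_def t_def int_per_diff_int_per\<close>)
  ultimately show ?thesis by blast
qed

lemma inj_on_per_diff: "x \<in> periodic_lattice v L \<Longrightarrow> inj_on (\<lambda>y. per_diff v L y x) (periodic_lattice v L)"
proof (rule inj_onI)
  fix y z assume x: "x \<in> periodic_lattice v L" and yz: "y \<in> periodic_lattice v L" "z \<in> periodic_lattice v L"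
    and eq: "per_diff v L y x = per_diff v L z x"
  have "coords v y i = coords v z i" for i
  proof -
    have "int_per L (coords v y i - coords v x i) = int_per L (coords v z i - coords v x i)"
      using arg_cong[OF eq, of "\<lambda>u. coords v u i"] x yz by (simp add: coords_per_diff)
    hence "int_per L (int_per L (coords v y i - coords v x i) + coords v x i)
         = int_per L (int_per L (coords v z i - coords v x i) + coords v x i)" by simp
    thus ?thesis
      using yz by (simp add: int_per_add_int_per int_per_self coords_box)
  qed
  hence "coords v y = coords v z" by auto
  thus "y = z"
    using yz periodic_lattice_subset by (metis lattice_point_coords subsetD)
qed

end

section \<open>Tightness of the jumps\<close>

lemma summable_on_finite_superlevel:
  fixes f :: "'a \<Rightarrow> real"
  assumes f: "f summable_on S" and nonneg: "\<And>x. x \<in> S \<Longrightarrow> f x \<ge> 0" and "c > 0"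
  shows "finite {x \<in> S. f x \<ge> c}"
proof (rule ccontr)
  assume "infinite {x \<in> S. f x \<ge> c}"
  then obtain T where T: "T \<subseteq> {x \<in> S. f x \<ge> c}" "finite T" "card T = nat \<lfloor>infsum f S / c\<rfloor> + 1"
    by (meson infinite_arbitrarily_large)
  have "infsum f S / c < card T" unfolding T(3) by linarith
  hence "infsum f S < (\<Sum>x\<in>T. c)" using \<open>c > 0\<close> by (simp add: field_simps)
  also have "\<dots> \<le> sum f T" using T(1) by (intro sum_mono) auto
  also have "\<dots> \<le> infsum f S"
    using T nonneg by (intro finite_sum_le_infsum[OF f]) auto
  finally show False by simp
qed

text \<open>
  Summability makes the energy tend to infinity along the lattice. For \<open>\<beta> \<le> 0\<close> the terms of the sum
  are bounded away from \<open>0\<close>, so that \<open>X\<close> itself is finite.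
\<close>

lemma finite_low_energy:
  fixes \<xi> :: "'a \<Rightarrow> real"
  assumes sum: "(\<lambda>x. exp (- \<beta> * \<xi> x)) summable_on X" and lower: "\<And>x. x \<in> X \<Longrightarrow> - b \<le> \<xi> x"
  shows "finite {x \<in> X. \<xi> x < K}"
proof (cases "\<beta> > 0")
  case True
  have "finite {x \<in> X. exp (- \<beta> * \<xi> x) \<ge> exp (- \<beta> * K)}"
    by (rule summable_on_finite_superlevel[OF sum]) auto
  thus ?thesis by (rule finite_subset[rotated]) (use True in auto)
next
  case False
  have "finite {x \<in> X. exp (- \<beta> * \<xi> x) \<ge> exp (\<beta> * b)}"
    by (rule summable_on_finite_superlevel[OF sum]) auto
  moreover have "\<beta> * b \<le> - \<beta> * \<xi> x" if "x \<in> X" for x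
    using mult_left_mono[OF lower[OF that], of "- \<beta>"] False by simp
  ultimately show ?thesis by (auto elim!: finite_subset[rotated])
qed

text \<open>
  The length of the jump from \<open>x\<close> to \<open>y\<close> is measured by its integer coordinates. In contrast to the
  Euclidean norm of the periodic difference, this is symmetric in \<open>x\<close> and \<open>y\<close> also for even \<open>L\<close>.
\<close>

definition long_jump :: "('d::finite \<Rightarrow> real^'d) \<Rightarrow> nat \<Rightarrow> int \<Rightarrow> real^'d \<Rightarrow> real^'d \<Rightarrow> bool" where
  "long_jump v L R x y \<longleftrightarrow> (\<exists>i. \<bar>coords v (per_diff v L y x) i\<bar> > R)"

lemma long_jump_sym:
  assumes "lattice_basis v" "L \<ge> 1" "x \<in> periodic_lattice v L" "y \<in> periodic_lattice v L"
  shows "long_jump v L R x y \<longleftrightarrow> long_jump v L R y x"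
  using abs_int_per_minus[OF \<open>L \<ge> 1\<close>, of "coords v x _ - coords v y _"] assms
  by (simp add: long_jump_def coords_per_diff)

lemma long_jump_if_norm:
  assumes "lattice_basis v" and "norm (per_diff v L y x) > of_int R * (\<Sum>i\<in>UNIV. norm (v i))"
  shows "long_jump v L R x y"
proof (rule ccontr)
  assume "\<not> long_jump v L R x y"
  hence "norm (lattice_point v (coords v (per_diff v L y x))) \<le> of_int R * (\<Sum>i\<in>UNIV. norm (v i))"
    by (intro norm_lattice_point_le) (auto simp: long_jump_def not_less)
  thus False
    using assms by (simp add: lattice_point_coords per_diff_in_lattice)
qed

text \<open>
  Outside a box around \<open>x\<close> that does not depend on \<open>L\<close>, every jump from \<open>x\<close> is long: wrapping around the torus
  does not increase the coordinates of a point.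
\<close>

lemma long_jump_if_far:
  assumes "lattice_basis v" "L \<ge> 1" "x \<in> periodic_lattice v L" "y \<in> periodic_lattice v L"
    and far: "y \<notin> lattice_point v ` {z. \<forall>i. \<bar>z i\<bar> \<le> \<bar>coords v x i\<bar> + R}"
  shows "long_jump v L R x y"
proof (rule ccontr)
  assume "\<not> long_jump v L R x y"
  hence short: "\<bar>int_per L (coords v y i - coords v x i)\<bar> \<le> R" for i
    using assms by (auto simp: long_jump_def not_less coords_per_diff)
  have "\<bar>coords v y i\<bar> \<le> \<bar>coords v x i\<bar> + R" for i
  proof -
    have "coords v y i = int_per L (int_per L (coords v y i - coords v x i) + coords v x i)"
      using assms by (simp add: int_per_add_int_per int_per_self coords_box)
    also have "\<bar>\<dots>\<bar> \<le> \<bar>int_per L (coords v y i - coords v x i) + coords v x i\<bar>"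
      by (rule abs_int_per_le[OF \<open>L \<ge> 1\<close>])
    finally show ?thesis using short[of i] by linarith
  qed
  moreover have "y = lattice_point v (coords v y)"
    using assms periodic_lattice_subset by (subst lattice_point_coords) auto
  ultimately show False using far by blast
qed

text \<open>
  The measure of spatial random permutations in finite volume as a discrete distribution; a jump
  from \<open>x\<close> to \<open>y\<close> has the energy \<open>\<xi> (y - x)\<close> with the periodic difference.
\<close>

definition srp_pmf ::
  "('d::finite \<Rightarrow> real^'d) \<Rightarrow> (real^'d \<Rightarrow> real) \<Rightarrow> real \<Rightarrow> nat \<Rightarrow> (real^'d \<Rightarrow> real^'d) pmf" where
  "srp_pmf v \<xi> \<alpha> L = gibbs_perm \<alpha> (\<lambda>x y. \<xi> (per_diff v L y x)) (periodic_lattice v L)"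

lemma set_srp_pmf: "set_pmf (srp_pmf v \<xi> \<alpha> L) = perms (periodic_lattice v L)"
  unfolding srp_pmf_def by (rule set_gibbs_perm[OF finite_periodic_lattice])

lemma AE_srp_pmf_fixed:
  assumes "x \<notin> periodic_lattice v L"
  shows "AE \<pi> in srp_pmf v \<xi> \<alpha> L. \<pi> x = x"
    and "AE \<pi> in srp_pmf v \<xi> \<alpha> L. inv \<pi> x = x"
  using assms
  by (auto simp: AE_measure_pmf_iff set_srp_pmf perms_def permutes_not_in
      permutes_not_in[OF permutes_inv])

lemma perms_mono: "A \<subseteq> B \<Longrightarrow> perms A \<subseteq> perms B"
  by (auto simp: perms_def intro: permutes_subset)

text \<open>The measure of a set outside the sigma-algebra is \<open>0\<close> by convention.\<close>

lemma measure_extended_srp: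
  "measure (extended_srp v \<xi> \<alpha> L) B =
     (if B \<in> sets (perm_space (regular_lattice v)) then measure_pmf.prob (srp_pmf v \<xi> \<alpha> L) B else 0)"
proof (cases "B \<in> sets (perm_space (regular_lattice v))")
  case True
  let ?A = "periodic_lattice v L" and ?\<phi> = "\<lambda>x y. \<xi> (per_diff v L y x)"
  note fin = finite_periodic_lattice[of v L]
  have w: "exp (- \<alpha> * hamiltonian v \<xi> L \<pi>) / partition_function v \<xi> \<alpha> L = pmf (srp_pmf v \<xi> \<alpha> L) \<pi>"
    if "\<pi> \<in> perms ?A" for \<pi>
    unfolding srp_pmf_def using that
    by (subst pmf_gibbs_perm[OF fin])
       (simp add: hamiltonian_def perm_energy_def partition_function_def gibbs_partition_def)
  have meas: "(\<lambda>\<pi>. \<pi>) \<in> finite_srp v \<xi> \<alpha> L \<rightarrow>\<^sub>M perm_space (regular_lattice v)"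
    unfolding finite_srp_def
    using perms_mono[OF periodic_lattice_subset[of v L]] by (auto simp: space_perm_space)
  have "measure (extended_srp v \<xi> \<alpha> L) B = measure (finite_srp v \<xi> \<alpha> L) (B \<inter> perms ?A)"
    unfolding extended_srp_def
    by (subst measure_distr[OF meas True]) (simp add: finite_srp_def space_point_measure)
  also have "\<dots> = (\<Sum>\<pi>\<in>B \<inter> perms ?A. exp (- \<alpha> * hamiltonian v \<xi> L \<pi>) / partition_function v \<xi> \<alpha> L)"
    unfolding finite_srp_def
    by (subst measure_point_measure_finite_if)
       (auto simp: finite_perms[OF fin] partition_function_def intro!: divide_nonneg_nonneg sum_nonneg)
  also have "\<dots> = (\<Sum>\<pi>\<in>B \<inter> perms ?A. pmf (srp_pmf v \<xi> \<alpha> L) \<pi>)"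
    by (intro sum.cong refl w) auto
  also have "\<dots> = measure_pmf.prob (srp_pmf v \<xi> \<alpha> L) (B \<inter> set_pmf (srp_pmf v \<xi> \<alpha> L))"
    unfolding set_srp_pmf by (simp add: measure_measure_pmf_finite finite_perms[OF fin])
  finally show ?thesis
    using True by (simp add: measure_Int_set_pmf)
qed (simp add: extended_srp_def measure_notin_sets)

text \<open>
  Tightness, uniform in \<open>L\<close> and \<open>x\<close>. The constant \<open>C\<close> of the energy bound does not depend on \<open>L\<close>
  because \<open>y \<mapsto> y - x\<close> embeds the torus into the lattice, and only finitely many lattice points have
  energy below a given level.
\<close>

lemma srp_long_jump_prob_le:
  assumes basis: "lattice_basis v" and energy: "jump_energy v \<xi>" and "\<epsilon> > 0"
    and sum: "(\<lambda>x. exp (- (\<alpha> - \<epsilon>) * \<xi> x)) summable_on regular_lattice v"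
    and "\<delta> > 0"
  shows "\<exists>R\<ge>0. \<forall>L\<ge>1. \<forall>x\<in>periodic_lattice v L.
    measure_pmf.prob (srp_pmf v \<xi> \<alpha> L) {\<pi>. long_jump v L R x (\<pi> x)} \<le> \<delta> \<and>
    measure_pmf.prob (srp_pmf v \<xi> \<alpha> L) {\<pi>. long_jump v L R (inv \<pi> x) x} \<le> \<delta>"
proof -
  let ?X = "regular_lattice v"
  obtain b where b: "- b \<le> \<xi> y" if "y \<in> ?X" for y
    using energy unfolding jump_energy_def bdd_below_def by (metis image_eqI minus_minus)
  define C where "C = (\<Sum>\<^sub>\<infinity>x\<in>?X. exp (- (\<alpha> - \<epsilon>) * \<xi> x))"
  have C_ge: "(\<Sum>y\<in>T. exp (- (\<alpha> - \<epsilon>) * \<xi> y)) \<le> C" if "finite T" "T \<subseteq> ?X" for T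
    unfolding C_def using that by (intro finite_sum_le_infsum[OF sum]) auto
  have "C > 0"
  proof -
    have "0 < (\<Sum>y\<in>{lattice_point v (\<lambda>_. 0)}. exp (- (\<alpha> - \<epsilon>) * \<xi> y))" by simp
    also have "\<dots> \<le> C" by (rule C_ge) (auto simp: regular_lattice_def)
    finally show ?thesis .
  qed
  define M where "M = (ln C + \<alpha> * \<xi> 0) / \<epsilon> + b"
  \<comment> \<open>At this energy level the Markov bound \<open>M / (K + b)\<close> is at most \<open>\<delta>\<close>.\<close>
  define K where "K = \<bar>M\<bar> / \<delta> + 1 - b"
  have "K + b > 0" using \<open>\<delta> > 0\<close> by (simp add: K_def add_nonneg_pos)
  have M_le: "M / (K + b) \<le> \<delta>"
  proof -
    have "M \<le> \<delta> * (K + b)" using \<open>\<delta> > 0\<close> by (simp add: K_def algebra_simps)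
    thus ?thesis using \<open>K + b > 0\<close> by (simp add: field_simps)
  qed
  have fin: "finite {y \<in> ?X. \<xi> y < K}"
    using sum b by (rule finite_low_energy)
  obtain R where R: "R \<ge> 0" "\<And>y i. y \<in> ?X \<Longrightarrow> \<xi> y < K \<Longrightarrow> \<bar>coords v y i\<bar> \<le> R"
  proof -
    let ?S = "insert 0 ((\<lambda>(y, i). \<bar>coords v y i\<bar>) ` ({y \<in> ?X. \<xi> y < K} \<times> UNIV))"
    have S: "finite ?S" using fin by simp
    show thesis
    proof (rule that)
      show "0 \<le> Max ?S" using S by (intro Max_ge) auto
      fix y i assume "y \<in> ?X" "\<xi> y < K"
      hence "\<bar>coords v y i\<bar> \<in> ?S" by (intro insertI2 image_eqI[of _ _ "(y, i)"]) auto
      thus "\<bar>coords v y i\<bar> \<le> Max ?S" using S by (rule Max_ge[rotated])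
    qed
  qed
  have "measure_pmf.prob (srp_pmf v \<xi> \<alpha> L) {\<pi>. long_jump v L R x (\<pi> x)} \<le> \<delta> \<and>
        measure_pmf.prob (srp_pmf v \<xi> \<alpha> L) {\<pi>. long_jump v L R (inv \<pi> x) x} \<le> \<delta>"
    if L: "L \<ge> 1" and x: "x \<in> periodic_lattice v L" for L x
  proof -
    let ?A = "periodic_lattice v L"
    note finA = finite_periodic_lattice[of v L]
    have bound: "(\<Sum>y\<in>?A. exp (- (\<alpha> - \<epsilon>) * \<xi> (per_diff v L y x))) \<le> C" if "x \<in> ?A" for x
    proof -
      have "(\<Sum>y\<in>?A. exp (- (\<alpha> - \<epsilon>) * \<xi> (per_diff v L y x)))
          = (\<Sum>u\<in>(\<lambda>y. per_diff v L y x) ` ?A. exp (- (\<alpha> - \<epsilon>) * \<xi> u))"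
        by (simp add: sum.reindex[OF inj_on_per_diff[OF basis that]])
      also have "\<dots> \<le> C"
        using finA by (intro C_ge) (auto simp: per_diff_in_lattice)
      finally show ?thesis .
    qed
    have diag: "\<xi> (per_diff v L x x) = \<xi> 0" for x
      by (simp add: per_diff_same[OF L])
    have high: "K \<le> \<xi> (per_diff v L y x)" if "long_jump v L R x y" for x y
      using that R(2)[OF per_diff_in_lattice[of v L y x]] unfolding long_jump_def by (meson not_le)
    have trans: "\<exists>\<tau>. \<tau> permutes ?A \<and> \<tau> x = x' \<and> (\<forall>y\<in>?A. \<forall>z\<in>?A.
        \<xi> (per_diff v L (\<tau> z) (\<tau> y)) = \<xi> (per_diff v L z y) \<and>
        long_jump v L R (\<tau> y) (\<tau> z) = long_jump v L R y z)" if x': "x \<in> ?A" "x' \<in> ?A" for x x'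
    proof -
      obtain \<tau> where \<tau>: "\<tau> permutes ?A" "\<tau> x = x'"
        "\<And>y z. y \<in> ?A \<Longrightarrow> z \<in> ?A \<Longrightarrow> per_diff v L (\<tau> y) (\<tau> z) = per_diff v L y z"
        using ex_periodic_translation[OF basis L x'] by blast
      show ?thesis
        by (rule exI[of _ \<tau>]) (simp add: \<tau> long_jump_def)
    qed
    note prob = gibbs_jump_prob_le[OF finA \<open>\<epsilon> > 0\<close> \<open>C > 0\<close>, where \<phi> = "\<lambda>x y. \<xi> (per_diff v L y x)"
        and U = "long_jump v L R" and K = K and b = b and e = "\<xi> 0" and x = x and \<alpha> = \<alpha>,
        OF bound diag b[OF per_diff_in_lattice] high \<open>K + b > 0\<close> trans x,
        folded srp_pmf_def M_def]
    show ?thesis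
      using prob M_le by (auto intro: order_trans)
  qed
  with R(1) show ?thesis by blast
qed

text \<open>The same bound for the Euclidean norm, also for points \<open>x\<close> outside the torus.\<close>

lemma srp_norm_jump_prob_le:
  assumes basis: "lattice_basis v" and energy: "jump_energy v \<xi>" and "\<epsilon> > 0"
    and sum: "(\<lambda>x. exp (- (\<alpha> - \<epsilon>) * \<xi> x)) summable_on regular_lattice v"
    and "\<delta> > 0"
  shows "\<exists>D>0. \<forall>L\<ge>1. \<forall>x.
    measure_pmf.prob (srp_pmf v \<xi> \<alpha> L) {\<pi>. norm (per_diff v L (\<pi> x) x) > D} \<le> \<delta> \<and>
    measure_pmf.prob (srp_pmf v \<xi> \<alpha> L) {\<pi>. norm (per_diff v L (inv \<pi> x) x) > D} \<le> \<delta>"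
proof -
  obtain R where "R \<ge> 0" and R: "\<And>L x. L \<ge> 1 \<Longrightarrow> x \<in> periodic_lattice v L \<Longrightarrow>
    measure_pmf.prob (srp_pmf v \<xi> \<alpha> L) {\<pi>. long_jump v L R x (\<pi> x)} \<le> \<delta> \<and>
    measure_pmf.prob (srp_pmf v \<xi> \<alpha> L) {\<pi>. long_jump v L R (inv \<pi> x) x} \<le> \<delta>"
    using srp_long_jump_prob_le[OF assms] by blast
  define D where "D = of_int R * (\<Sum>i\<in>UNIV. norm (v i)) + 1"
  have "D > 0"
    unfolding D_def using \<open>R \<ge> 0\<close> by (intro add_nonneg_pos mult_nonneg_nonneg sum_nonneg) auto
  have long: "long_jump v L R x y" if "norm (per_diff v L y x) > D" for L x y
    using that by (intro long_jump_if_norm[OF basis]) (simp add: D_def)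
  have "measure_pmf.prob (srp_pmf v \<xi> \<alpha> L) {\<pi>. norm (per_diff v L (\<pi> x) x) > D} \<le> \<delta> \<and>
        measure_pmf.prob (srp_pmf v \<xi> \<alpha> L) {\<pi>. norm (per_diff v L (inv \<pi> x) x) > D} \<le> \<delta>"
    if L: "L \<ge> 1" for L x
  proof (cases "x \<in> periodic_lattice v L")
    case True
    let ?p = "srp_pmf v \<xi> \<alpha> L"
    have "measure_pmf.prob ?p {\<pi>. norm (per_diff v L (\<pi> x) x) > D}
        \<le> measure_pmf.prob ?p {\<pi>. long_jump v L R x (\<pi> x)}"
      using long by (intro measure_pmf.finite_measure_mono) auto
    moreover have "measure_pmf.prob ?p {\<pi>. norm (per_diff v L (inv \<pi> x) x) > D}
        \<le> measure_pmf.prob ?p {\<pi>. long_jump v L R (inv \<pi> x) x}"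
    proof (intro measure_pmf.finite_measure_mono_AE AE_pmfI impI)
      fix \<pi> assume "\<pi> \<in> set_pmf ?p" and far: "\<pi> \<in> {\<pi>. norm (per_diff v L (inv \<pi> x) x) > D}"
      hence "inv \<pi> x \<in> periodic_lattice v L"
        using True by (auto simp: set_srp_pmf perms_def permutes_in_image[OF permutes_inv])
      moreover have "long_jump v L R x (inv \<pi> x)" using far long by auto
      ultimately show "\<pi> \<in> {\<pi>. long_jump v L R (inv \<pi> x) x}"
        using long_jump_sym[OF basis L True] by simp
    qed auto
    ultimately show ?thesis
      using R[OF L True] by (auto intro: order_trans)
  next
    case False
    \<comment> \<open>Points outside the torus do not move.\<close>
    have "AE \<pi> in srp_pmf v \<xi> \<alpha> L. \<not> norm (per_diff v L (\<pi> x) x) > D"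
      "AE \<pi> in srp_pmf v \<xi> \<alpha> L. \<not> norm (per_diff v L (inv \<pi> x) x) > D"
      using \<open>D > 0\<close> by (auto intro: eventually_mono[OF AE_srp_pmf_fixed(1)[OF False]]
          eventually_mono[OF AE_srp_pmf_fixed(2)[OF False]] simp: per_diff_same[OF L])
    hence "measure_pmf.prob (srp_pmf v \<xi> \<alpha> L) {\<pi>. norm (per_diff v L (\<pi> x) x) > D} = 0"
      "measure_pmf.prob (srp_pmf v \<xi> \<alpha> L) {\<pi>. norm (per_diff v L (inv \<pi> x) x) > D} = 0"
      by (simp_all add: measure_pmf.prob_eq_0)
    thus ?thesis using \<open>\<delta> > 0\<close> by simp
  qed
  with \<open>D > 0\<close> show ?thesis by blast
qed

lemma ex_infinite_volume_srp:
  assumes basis: "lattice_basis v" and energy: "jump_energy v \<xi>" and "\<epsilon> > 0"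
    and sum: "(\<lambda>x. exp (- (\<alpha> - \<epsilon>) * \<xi> x)) summable_on regular_lattice v"
  shows "\<exists>P. infinite_volume_srp v \<xi> \<alpha> P"
proof -
  let ?X = "regular_lattice v" and ?p = "\<lambda>n. srp_pmf v \<xi> \<alpha> (Suc n)"
  have tight: "\<exists>K. finite K \<and> (\<forall>n. measure_pmf.prob (?p n) {\<pi>. \<pi> x \<notin> K} \<le> \<delta>
      \<and> measure_pmf.prob (?p n) {\<pi>. inv \<pi> x \<notin> K} \<le> \<delta>)"
    if x: "x \<in> ?X" and "\<delta> > 0" for x \<delta>
  proof -
    obtain R where "R \<ge> 0" and R: "\<And>L x. L \<ge> 1 \<Longrightarrow> x \<in> periodic_lattice v L \<Longrightarrow>
      measure_pmf.prob (srp_pmf v \<xi> \<alpha> L) {\<pi>. long_jump v L R x (\<pi> x)} \<le> \<delta> \<and>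
      measure_pmf.prob (srp_pmf v \<xi> \<alpha> L) {\<pi>. long_jump v L R (inv \<pi> x) x} \<le> \<delta>"
      using srp_long_jump_prob_le[OF assms \<open>\<delta> > 0\<close>] by blast
    define K where "K = lattice_point v ` {z. \<forall>i. \<bar>z i\<bar> \<le> \<bar>coords v x i\<bar> + R}"
    have "finite {a. \<bar>a\<bar> \<le> c}" for c :: int
      by (rule finite_subset[of _ "{- c..c}"]) auto
    hence "finite K"
      unfolding K_def using finite_lattice_box[of "\<lambda>i. {a. \<bar>a\<bar> \<le> \<bar>coords v x i\<bar> + R}"] by simp
    have "x \<in> K"
      unfolding K_def using lattice_point_coords[OF basis x] \<open>R \<ge> 0\<close>
      by (intro image_eqI[of _ _ "coords v x"]) auto
    have "measure_pmf.prob (?p n) {\<pi>. \<pi> x \<notin> K} \<le> \<delta> \<and> measure_pmf.prob (?p n) {\<pi>. inv \<pi> x \<notin> K} \<le> \<delta>" for n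
    proof (cases "x \<in> periodic_lattice v (Suc n)")
      case True
      have far: "long_jump v (Suc n) R x y \<and> long_jump v (Suc n) R y x"
        if "y \<in> periodic_lattice v (Suc n)" "y \<notin> K" for y
        using long_jump_if_far[OF basis _ True that(1), of R] that
          long_jump_sym[OF basis _ True that(1), of R] by (simp add: K_def)
      have perm: "\<pi> x \<in> periodic_lattice v (Suc n)" "inv \<pi> x \<in> periodic_lattice v (Suc n)"
        if "\<pi> \<in> set_pmf (?p n)" for \<pi>
        using that True by (auto simp: set_srp_pmf perms_def permutes_in_image permutes_in_image[OF permutes_inv])
      have "measure_pmf.prob (?p n) {\<pi>. \<pi> x \<notin> K}
          \<le> measure_pmf.prob (?p n) {\<pi>. long_jump v (Suc n) R x (\<pi> x)}"
        using far perm by (intro measure_pmf.finite_measure_mono_AE AE_pmfI) auto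
      moreover have "measure_pmf.prob (?p n) {\<pi>. inv \<pi> x \<notin> K}
          \<le> measure_pmf.prob (?p n) {\<pi>. long_jump v (Suc n) R (inv \<pi> x) x}"
        using far perm by (intro measure_pmf.finite_measure_mono_AE AE_pmfI) auto
      ultimately show ?thesis
        using R[OF _ True] by (auto intro: order_trans)
    next
      case False
      have "AE \<pi> in ?p n. \<not> \<pi> x \<notin> K" "AE \<pi> in ?p n. \<not> inv \<pi> x \<notin> K"
        using \<open>x \<in> K\<close> by (auto intro: eventually_mono[OF AE_srp_pmf_fixed(1)[OF False]]
            eventually_mono[OF AE_srp_pmf_fixed(2)[OF False]])
      hence "measure_pmf.prob (?p n) {\<pi>. \<pi> x \<notin> K} = 0" "measure_pmf.prob (?p n) {\<pi>. inv \<pi> x \<notin> K} = 0"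
        by (simp_all add: measure_pmf.prob_eq_0)
      thus ?thesis using \<open>\<delta> > 0\<close> by simp
    qed
    with \<open>finite K\<close> show ?thesis by blast
  qed
  have perms: "set_pmf (?p n) \<subseteq> perms ?X" for n
    unfolding set_srp_pmf by (rule perms_mono[OF periodic_lattice_subset])
  obtain P r where P: "prob_space P" "sets P = sets (perm_space ?X)" and r: "strict_mono (r :: nat \<Rightarrow> nat)"
    and lim: "\<And>B. B \<in> cylinder_semiring ?X \<Longrightarrow> (\<lambda>n. measure_pmf.prob (?p (r n)) B) \<longlonglongrightarrow> measure P B"
  proof (rule tight_perms_subsequence[OF countable_regular_lattice perms])
    show "\<exists>K. finite K \<and> (\<forall>n. measure_pmf.prob (?p n) {\<pi>. \<pi> x \<notin> K} \<le> \<delta>)"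
      "\<exists>K. finite K \<and> (\<forall>n. measure_pmf.prob (?p n) {\<pi>. inv \<pi> x \<notin> K} \<le> \<delta>)"
      if "x \<in> ?X" "\<delta> > 0" for x \<delta>
      using tight[OF that] by blast+
  qed (rule that)
  have "infinite_volume_srp v \<xi> \<alpha> P"
    unfolding infinite_volume_srp_def
  proof (intro conjI exI[of _ "\<lambda>n. Suc (r n)"] allI ballI)
    show "strict_mono (\<lambda>n. Suc (r n))" using r by (simp add: strict_mono_def)
    fix B assume B: "B \<in> cylinder_semiring ?X"
    thus "(\<lambda>n. measure (extended_srp v \<xi> \<alpha> (Suc (r n))) B) \<longlonglongrightarrow> measure P B"
      using lim by (simp add: measure_extended_srp cylinder_semiring_sets)
  qed (use P in auto)
  thus ?thesis ..
qed

section \<open>Tightness and existence of the infinite volume measure\<close>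

theorem theorem3p1:
  fixes v :: "'d::finite \<Rightarrow> real^'d"
    and \<xi> :: "real^'d \<Rightarrow> real"
    and \<alpha> :: real
  assumes "lattice_basis v"
    and "jump_energy v \<xi>"
    and "\<alpha> > 0"
    and "\<exists>\<epsilon>>0. (\<lambda>x. exp (- (\<alpha> - \<epsilon>) * \<xi> x)) summable_on regular_lattice v"
  shows "(\<forall>x\<in>regular_lattice v. \<forall>\<delta>>0. \<exists>D>0.
            (SUP L\<in>{1..}. measure (extended_srp v \<xi> \<alpha> L)
               {\<pi> \<in> perms (regular_lattice v). norm (per_diff v L (\<pi> x) x) > D}) < \<delta> \<and>
            (SUP L\<in>{1..}. measure (extended_srp v \<xi> \<alpha> L)
               {\<pi> \<in> perms (regular_lattice v). norm (per_diff v L (inv \<pi> x) x) > D}) < \<delta>)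
         \<and> (\<exists>P. infinite_volume_srp v \<xi> \<alpha> P)"
proof (intro conjI ballI allI impI)
  obtain \<epsilon> where \<epsilon>: "\<epsilon> > 0" "(\<lambda>x. exp (- (\<alpha> - \<epsilon>) * \<xi> x)) summable_on regular_lattice v"
    using assms(4) by blast
  show "\<exists>P. infinite_volume_srp v \<xi> \<alpha> P"
    by (rule ex_infinite_volume_srp[OF assms(1,2) \<epsilon>])
  fix x and \<delta> :: real assume "x \<in> regular_lattice v" "\<delta> > 0"
  hence "\<delta> / 2 > 0" by simp
  then obtain D where "D > 0" and D: "\<And>L x. L \<ge> 1 \<Longrightarrow>
      measure_pmf.prob (srp_pmf v \<xi> \<alpha> L) {\<pi>. norm (per_diff v L (\<pi> x) x) > D} \<le> \<delta> / 2 \<and>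
      measure_pmf.prob (srp_pmf v \<xi> \<alpha> L) {\<pi>. norm (per_diff v L (inv \<pi> x) x) > D} \<le> \<delta> / 2"
    using srp_norm_jump_prob_le[OF assms(1,2) \<epsilon>] by meson
  have le: "measure (extended_srp v \<xi> \<alpha> L) {\<pi> \<in> perms (regular_lattice v). Q \<pi>}
      \<le> measure_pmf.prob (srp_pmf v \<xi> \<alpha> L) {\<pi>. Q \<pi>}" for L Q
    by (auto simp: measure_extended_srp intro!: measure_pmf.finite_measure_mono)
  have sup: "(SUP L\<in>{1..}. measure (extended_srp v \<xi> \<alpha> L) {\<pi> \<in> perms (regular_lattice v). Q L \<pi>}) < \<delta>"
    if "\<And>L. L \<ge> 1 \<Longrightarrow> measure_pmf.prob (srp_pmf v \<xi> \<alpha> L) {\<pi>. Q L \<pi>} \<le> \<delta> / 2" for Q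
  proof -
    have "(SUP L\<in>{1..}. measure (extended_srp v \<xi> \<alpha> L) {\<pi> \<in> perms (regular_lattice v). Q L \<pi>}) \<le> \<delta> / 2"
      by (intro cSUP_least order_trans[OF le that]) auto
    thus ?thesis using \<open>\<delta> > 0\<close> by linarith
  qed
  show "\<exists>D>0.
      (SUP L\<in>{1..}. measure (extended_srp v \<xi> \<alpha> L)
         {\<pi> \<in> perms (regular_lattice v). norm (per_diff v L (\<pi> x) x) > D}) < \<delta> \<and>
      (SUP L\<in>{1..}. measure (extended_srp v \<xi> \<alpha> L)
         {\<pi> \<in> perms (regular_lattice v). norm (per_diff v L (inv \<pi> x) x) > D}) < \<delta>"
    using \<open>D > 0\<close> D by (intro exI[of _ D] conjI sup) auto
qed

end
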